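(* Let $\overline{M}$ be a smooth manifold, let $S$ and $W$ be compact smooth manifolds, and let $H$ and $F$ be Lie groups acting smoothly on the left on $S$ and $W$ respectively. Let $(\overline{U}_\alpha)_{\alpha\in A}$ be an open cover of $\overline{M}$, let $(h_{\alpha\beta})$ be an $H$-cocycle and $(f_{\alpha\beta})$ an $F$-cocycle for this cover. On the disjoint union $$\Sigma:=\coprod_{\alpha\in A}\{\alpha\}\times\overline{U}_\alpha\times S\times W$$ define the relation: $(\alpha,p,x,y)\sim(\beta,p',x',y')$ if and only if $p=p'$, $x=h_{\alpha\beta}(p)\cdot x'$ and $y=f_{\alpha\beta}(p)\cdot y'$. Then $\sim$ is an equivalence relation. Let $M:=\Sigma/\sim$, let $\pi:M\to\overline{M}$ be $\pi([\alpha,p,x,y])=p$, and for each $\alpha$ let $\phi_\alpha:\pi^{-1}(\overline{U}_\alpha)\to\overline{U}_\alpha\times S\times W$ be the map sending $m$ to the unique $(p,x,y)$ such that $(\alpha,p,x,y)\in m$. Then the maps $\phi_\alpha$ are well defined, and $M$ carries a smooth manifold structure for which $\pi:M\to\overline{M}$ is a fiber bundle with fiber $S\times W$ and $(\overline{U}_\alpha,\phi_\alpha)_{\alpha\in A}$ is a bundle atlas. Moreover $(\overline{U}_\alpha,\phi_\alpha)_{\alpha\in A}$ is an $(S,W)$-multi-fiber atlas, so that $\pi:M\to\overline{M}$ is a multi-fiber bundle with fibers $(S,W)$.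
   Context: Cocycles: an $H$-cocycle for the open cover $(\overline{U}_\alpha)$ is an assignment of a smooth map $h_{\alpha\beta}:\overline{U}_\alpha\cap\overline{U}_\beta\to H$ to every nonempty intersection such that $h_{\alpha\alpha}(p)=\mathrm{Id}$, $h_{\alpha\beta}(p)=h_{\beta\alpha}(p)^{-1}$ and $h_{\alpha\beta}(p)\,h_{\beta\gamma}(p)=h_{\alpha\gamma}(p)$ wherever these are defined. An $F$-cocycle is defined in the same way. Multi-fiber bundle: let $S,W$ be compact manifolds and let $\pi:M\to\overline{M}$ be a smooth fiber bundle with fiber $S\times W$. A bundle chart is a pair $(\overline{U},\phi)$ with $\overline{U}\subset\overline{M}$ open and $\phi:\pi^{-1}(\overline{U})\to\overline{U}\times S\times W$ a diffeomorphism whose first component is $\pi$; write $\phi=(\pi,h,f)$ with $h:\pi^{-1}(\overline{U})\to S$ and $f:\pi^{-1}(\overline{U})\to W$. A bundle atlas is a family of bundle charts whose domains $\overline{U}$ cover $\overline{M}$. A bundle atlas $(\overline{U}_\alpha,\phi_\alpha)_{\alpha\in A}$, $\phi_\alpha=(\pi,h_\alpha,f_\alpha)$, is called an $(S,W)$-multi-fiber atlas if for all $\alpha,\beta\in A$ with $\overline{U}_\alpha\cap\overline{U}_\beta\neq\emptyset$ and all $m\in\pi^{-1}(\overline{U}_\alpha\cap\overline{U}_\beta)$: (i) $\phi_\alpha^{-1}(\{\pi(m)\}\times S\times\{f_\alpha(m)\})=\phi_\beta^{-1}(\{\pi(m)\}\times S\times\{f_\beta(m)\})$; (ii) $\phi_\alpha^{-1}(\{\pi(m)\}\times\{h_\alpha(m)\}\times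 W)=\phi_\beta^{-1}(\{\pi(m)\}\times\{h_\beta(m)\}\times W)$. The bundle is a multi-fiber bundle with fibers $(S,W)$ if it admits an $(S,W)$-multi-fiber atlas. *)

theory Defs
  imports "HOL-Analysis.Analysis" "HOL-Algebra.Group_Action"
begin

section \<open>Smooth maps between open sets of finite-dimensional normed spaces\<close>

text \<open>
  Model spaces are normed spaces in which a finite set spans. The class \<open>euclidean_space\<close>
  is not used because it has no zero-dimensional instance, which would exclude discrete Lie groups
  and finite fibers.
\<close>

definition finite_dimensional :: "'a::real_vector itself \<Rightarrow> bool" where
  "finite_dimensional _ \<longleftrightarrow> (\<exists>b::'a set. finite b \<and> span b = UNIV)"

text \<open>Only meant for open sets \<open>U\<close> in finite-dimensional spaces.\<close>

primrec Ck_on :: "nat \<Rightarrow> 'a::real_normed_vector set \<Rightarrow> ('a \<Rightarrow> 'b::real_normed_vector) \<Rightarrow> bool"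
  where
    "Ck_on 0 U f \<longleftrightarrow> continuous_on U f"
  | "Ck_on (Suc k) U f \<longleftrightarrow>
      (\<forall>x\<in>U. f differentiable (at x)) \<and> (\<forall>v. Ck_on k U (\<lambda>x. frechet_derivative f (at x) v))"

definition smooth_on :: "'a::real_normed_vector set \<Rightarrow> ('a \<Rightarrow> 'b::real_normed_vector) \<Rightarrow> bool"
  where "smooth_on U f \<longleftrightarrow> (\<forall>k. Ck_on k U f)"

section \<open>Smooth manifolds\<close>

text \<open>
  A chart is a pair of a domain and a coordinate map; values of the coordinate map outside the
  domain are irrelevant. The atlas need not be maximal.
\<close>

record ('a, 'e) mfd =
  top_of :: "'a topology"
  charts :: "('a set \<times> ('a \<Rightarrow> 'e)) set"

abbreviation pts :: "('a, 'e) mfd \<Rightarrow> 'a set" where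
  "pts X \<equiv> topspace (top_of X)"

definition is_chart :: "'a topology \<Rightarrow> 'a set \<Rightarrow> ('a \<Rightarrow> 'e::real_normed_vector) \<Rightarrow> bool" where
  "is_chart T V \<psi> \<longleftrightarrow>
    openin T V \<and> open (\<psi> ` V) \<and>
    homeomorphic_map (subtopology T V) (top_of_set (\<psi> ` V)) \<psi>"

definition smooth_manifold :: "('a, 'e::real_normed_vector) mfd \<Rightarrow> bool" where
  "smooth_manifold X \<longleftrightarrow>
    finite_dimensional TYPE('e) \<and>
    Hausdorff_space (top_of X) \<and> second_countable (top_of X) \<and>
    (\<forall>(V, \<psi>) \<in> charts X. is_chart (top_of X) V \<psi>) \<and>
    (\<Union>(V, \<psi>) \<in> charts X. V) = pts X \<and>
    (\<forall>(V, \<psi>) \<in> charts X. \<forall>(V', \<psi>') \<in> charts X.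
      smooth_on (\<psi> ` (V \<inter> V')) (\<psi>' \<circ> inv_into V \<psi>))"

definition smooth_map ::
  "('a, 'd::real_normed_vector) mfd \<Rightarrow> ('b, 'e::real_normed_vector) mfd \<Rightarrow> ('a \<Rightarrow> 'b) \<Rightarrow> bool"
  where
  "smooth_map X Y f \<longleftrightarrow>
    continuous_map (top_of X) (top_of Y) f \<and>
    (\<forall>(V, \<psi>) \<in> charts X. \<forall>(V', \<psi>') \<in> charts Y.
      smooth_on (\<psi> ` (V \<inter> f -` V')) (\<psi>' \<circ> f \<circ> inv_into V \<psi>))"

definition diffeomorphism ::
  "('a, 'd::real_normed_vector) mfd \<Rightarrow> ('b, 'e::real_normed_vector) mfd \<Rightarrow> ('a \<Rightarrow> 'b) \<Rightarrow> bool"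
  where
  "diffeomorphism X Y f \<longleftrightarrow>
    (\<exists>g. smooth_map X Y f \<and> smooth_map Y X g \<and>
      (\<forall>x \<in> pts X. g (f x) = x) \<and> (\<forall>y \<in> pts Y. f (g y) = y))"

definition open_submfd :: "('a, 'e) mfd \<Rightarrow> 'a set \<Rightarrow> ('a, 'e) mfd" where
  "open_submfd X U =
    \<lparr>top_of = subtopology (top_of X) U, charts = (\<lambda>(V, \<psi>). (V \<inter> U, \<psi>)) ` charts X\<rparr>"

definition prod_mfd :: "('a, 'd) mfd \<Rightarrow> ('b, 'e) mfd \<Rightarrow> ('a \<times> 'b, 'd \<times> 'e) mfd"
  (infixr \<open>\<times>\<^sub>M\<close> 75) where
  "X \<times>\<^sub>M Y =
    \<lparr>top_of = prod_topology (top_of X) (top_of Y),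
     charts = (\<lambda>((V, \<psi>), (V', \<psi>')). (V \<times> V', map_prod \<psi> \<psi>')) ` (charts X \<times> charts Y)\<rparr>"

section \<open>Lie groups and smooth actions\<close>

definition lie_group :: "'g monoid \<Rightarrow> ('g, 'e::real_normed_vector) mfd \<Rightarrow> bool" where
  "lie_group G X \<longleftrightarrow>
    group G \<and> smooth_manifold X \<and> carrier G = pts X \<and>
    smooth_map (X \<times>\<^sub>M X) X (\<lambda>(a, b). a \<otimes>\<^bsub>G\<^esub> b) \<and>
    smooth_map X X (\<lambda>a. inv\<^bsub>G\<^esub> a)"

definition smooth_left_action ::
  "'g monoid \<Rightarrow> ('g, 'd::real_normed_vector) mfd \<Rightarrow> ('s, 'e::real_normed_vector) mfd \<Rightarrow>
    ('g \<Rightarrow> 's \<Rightarrow> 's) \<Rightarrow> bool" where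
  "smooth_left_action G X S act \<longleftrightarrow>
    group_action G (pts S) act \<and> smooth_map (X \<times>\<^sub>M S) S (\<lambda>(g, x). act g x)"

section \<open>Open covers and cocycles\<close>

definition open_cover :: "('b, 'e) mfd \<Rightarrow> 'i set \<Rightarrow> ('i \<Rightarrow> 'b set) \<Rightarrow> bool" where
  "open_cover B A U \<longleftrightarrow> (\<forall>\<alpha>\<in>A. openin (top_of B) (U \<alpha>)) \<and> (\<Union>\<alpha>\<in>A. U \<alpha>) = pts B"

definition cocycle ::
  "'g monoid \<Rightarrow> ('g, 'd::real_normed_vector) mfd \<Rightarrow> ('b, 'e::real_normed_vector) mfd \<Rightarrow>
    'i set \<Rightarrow> ('i \<Rightarrow> 'b set) \<Rightarrow> ('i \<Rightarrow> 'i \<Rightarrow> 'b \<Rightarrow> 'g) \<Rightarrow> bool" where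
  "cocycle G X B A U c \<longleftrightarrow>
    (\<forall>\<alpha>\<in>A. \<forall>\<beta>\<in>A. U \<alpha> \<inter> U \<beta> \<noteq> {} \<longrightarrow> smooth_map (open_submfd B (U \<alpha> \<inter> U \<beta>)) X (c \<alpha> \<beta>)) \<and>
    (\<forall>\<alpha>\<in>A. \<forall>p \<in> U \<alpha>. c \<alpha> \<alpha> p = \<one>\<^bsub>G\<^esub>) \<and>
    (\<forall>\<alpha>\<in>A. \<forall>\<beta>\<in>A. \<forall>p \<in> U \<alpha> \<inter> U \<beta>. c \<alpha> \<beta> p = inv\<^bsub>G\<^esub> (c \<beta> \<alpha> p)) \<and>
    (\<forall>\<alpha>\<in>A. \<forall>\<beta>\<in>A. \<forall>\<gamma>\<in>A. \<forall>p \<in> U \<alpha> \<inter> U \<beta> \<inter> U \<gamma>.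
      c \<alpha> \<beta> p \<otimes>\<^bsub>G\<^esub> c \<beta> \<gamma> p = c \<alpha> \<gamma> p)"

section \<open>Fiber bundles and multi-fiber bundles\<close>

abbreviation preim :: "('m, 'd) mfd \<Rightarrow> ('m \<Rightarrow> 'b) \<Rightarrow> 'b set \<Rightarrow> 'm set" where
  "preim M \<pi> U \<equiv> {m \<in> pts M. \<pi> m \<in> U}"

definition bundle_chart ::
  "('m, 'd::real_normed_vector) mfd \<Rightarrow> ('b, 'e::real_normed_vector) mfd \<Rightarrow>
    ('f, 'k::real_normed_vector) mfd \<Rightarrow> ('m \<Rightarrow> 'b) \<Rightarrow> 'b set \<Rightarrow> ('m \<Rightarrow> 'b \<times> 'f) \<Rightarrow> bool" where
  "bundle_chart M B F \<pi> U \<phi> \<longleftrightarrow>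
    openin (top_of B) U \<and>
    diffeomorphism (open_submfd M (preim M \<pi> U)) (open_submfd B U \<times>\<^sub>M F) \<phi> \<and>
    (\<forall>m \<in> preim M \<pi> U. fst (\<phi> m) = \<pi> m)"

definition bundle_atlas ::
  "('m, 'd::real_normed_vector) mfd \<Rightarrow> ('b, 'e::real_normed_vector) mfd \<Rightarrow>
    ('f, 'k::real_normed_vector) mfd \<Rightarrow> ('m \<Rightarrow> 'b) \<Rightarrow>
    'i set \<Rightarrow> ('i \<Rightarrow> 'b set) \<Rightarrow> ('i \<Rightarrow> 'm \<Rightarrow> 'b \<times> 'f) \<Rightarrow> bool" where
  "bundle_atlas M B F \<pi> A U \<phi> \<longleftrightarrow>
    (\<forall>\<alpha>\<in>A. bundle_chart M B F \<pi> (U \<alpha>) (\<phi> \<alpha>)) \<and> (\<Union>\<alpha>\<in>A. U \<alpha>) = pts B"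

text \<open>
  Surjectivity of \<open>\<pi>\<close> is not a separate clause: it follows from local triviality unless
  \<open>F\<close> is empty.
\<close>

definition fiber_bundle ::
  "('m, 'd::real_normed_vector) mfd \<Rightarrow> ('b, 'e::real_normed_vector) mfd \<Rightarrow>
    ('f, 'k::real_normed_vector) mfd \<Rightarrow> ('m \<Rightarrow> 'b) \<Rightarrow> bool" where
  "fiber_bundle M B F \<pi> \<longleftrightarrow>
    smooth_manifold M \<and> smooth_manifold B \<and> smooth_manifold F \<and> smooth_map M B \<pi> \<and>
    (\<forall>p \<in> pts B. \<exists>U \<phi>. p \<in> U \<and> bundle_chart M B F \<pi> U \<phi>)"

text \<open>
  With \<open>\<phi>\<^sub>\<alpha> = (\<pi>, h\<^sub>\<alpha>, f\<^sub>\<alpha>)\<close>, the component \<open>h\<^sub>\<alpha>\<close> is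
  \<open>fst \<circ> snd \<circ> \<phi> \<alpha>\<close> and \<open>f\<^sub>\<alpha>\<close> is \<open>snd \<circ> snd \<circ> \<phi> \<alpha>\<close>; the inverse image of a set under
  \<open>\<phi> \<alpha>\<close> is taken inside its domain \<open>preim M \<pi> (U \<alpha>)\<close>.
\<close>

definition multi_fiber_atlas ::
  "('m, 'd::real_normed_vector) mfd \<Rightarrow> ('b, 'e::real_normed_vector) mfd \<Rightarrow>
    ('s, 'k::real_normed_vector) mfd \<Rightarrow> ('w, 'l::real_normed_vector) mfd \<Rightarrow> ('m \<Rightarrow> 'b) \<Rightarrow>
    'i set \<Rightarrow> ('i \<Rightarrow> 'b set) \<Rightarrow> ('i \<Rightarrow> 'm \<Rightarrow> 'b \<times> 's \<times> 'w) \<Rightarrow> bool" where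
  "multi_fiber_atlas M B S W \<pi> A U \<phi> \<longleftrightarrow>
    bundle_atlas M B (S \<times>\<^sub>M W) \<pi> A U \<phi> \<and>
    (\<forall>\<alpha>\<in>A. \<forall>\<beta>\<in>A. U \<alpha> \<inter> U \<beta> \<noteq> {} \<longrightarrow> (\<forall>m \<in> preim M \<pi> (U \<alpha> \<inter> U \<beta>).
      {n \<in> preim M \<pi> (U \<alpha>). \<phi> \<alpha> n \<in> {\<pi> m} \<times> pts S \<times> {snd (snd (\<phi> \<alpha> m))}} =
      {n \<in> preim M \<pi> (U \<beta>). \<phi> \<beta> n \<in> {\<pi> m} \<times> pts S \<times> {snd (snd (\<phi> \<beta> m))}} \<and>
      {n \<in> preim M \<pi> (U \<alpha>). \<phi> \<alpha> n \<in> {\<pi> m} \<times> {fst (snd (\<phi> \<alpha> m))} \<times> pts W} =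
      {n \<in> preim M \<pi> (U \<beta>). \<phi> \<beta> n \<in> {\<pi> m} \<times> {fst (snd (\<phi> \<beta> m))} \<times> pts W}))"

text \<open>
  Existence of an atlas is stated for a set of charts indexed by itself; this loses no generality,
  since a family of charts may be replaced by its range.
\<close>

definition multi_fiber_bundle ::
  "('m, 'd::real_normed_vector) mfd \<Rightarrow> ('b, 'e::real_normed_vector) mfd \<Rightarrow>
    ('s, 'k::real_normed_vector) mfd \<Rightarrow> ('w, 'l::real_normed_vector) mfd \<Rightarrow>
    ('m \<Rightarrow> 'b) \<Rightarrow> bool" where
  "multi_fiber_bundle M B S W \<pi> \<longleftrightarrow>
    compact_space (top_of S) \<and> compact_space (top_of W) \<and>
    smooth_manifold S \<and> smooth_manifold W \<and>
    fiber_bundle M B (S \<times>\<^sub>M W) \<pi> \<and>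
    (\<exists>C. multi_fiber_atlas M B S W \<pi> C fst snd)"

section \<open>Gluing along cocycles\<close>

definition glue_total ::
  "'i set \<Rightarrow> ('i \<Rightarrow> 'b set) \<Rightarrow> 's set \<Rightarrow> 'w set \<Rightarrow> ('i \<times> 'b \<times> 's \<times> 'w) set" where
  "glue_total A U S W = (SIGMA \<alpha>:A. U \<alpha> \<times> S \<times> W)"

definition glue_rel ::
  "'i set \<Rightarrow> ('i \<Rightarrow> 'b set) \<Rightarrow> 's set \<Rightarrow> 'w set \<Rightarrow>
    ('g \<Rightarrow> 's \<Rightarrow> 's) \<Rightarrow> ('i \<Rightarrow> 'i \<Rightarrow> 'b \<Rightarrow> 'g) \<Rightarrow>
    ('k \<Rightarrow> 'w \<Rightarrow> 'w) \<Rightarrow> ('i \<Rightarrow> 'i \<Rightarrow> 'b \<Rightarrow> 'k) \<Rightarrow>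
    (('i \<times> 'b \<times> 's \<times> 'w) \<times> ('i \<times> 'b \<times> 's \<times> 'w)) set" where
  "glue_rel A U S W act\<^sub>S h act\<^sub>W f =
    {((\<alpha>, p, x, y), (\<beta>, p', x', y')) | \<alpha> p x y \<beta> p' x' y'.
      (\<alpha>, p, x, y) \<in> glue_total A U S W \<and> (\<beta>, p', x', y') \<in> glue_total A U S W \<and>
      p = p' \<and> x = act\<^sub>S (h \<alpha> \<beta> p) x' \<and> y = act\<^sub>W (f \<alpha> \<beta> p) y'}"

definition glue_proj :: "('i \<times> 'b \<times> 's \<times> 'w) set \<Rightarrow> 'b" where
  "glue_proj m = (THE p. \<exists>\<alpha> x y. (\<alpha>, p, x, y) \<in> m)"

definition glue_chart :: "'i \<Rightarrow> ('i \<times> 'b \<times> 's \<times> 'w) set \<Rightarrow> 'b \<times> 's \<times> 'w" where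
  "glue_chart \<alpha> m = (THE q. (\<alpha>, q) \<in> m)"

end

theory Submission
  imports Defs
begin

text \<open>
  Over \<open>U \<alpha>\<close> the quotient is a copy of \<open>U \<alpha> \<times> S \<times> W\<close>, and two copies are compared by
  \<open>(p, x, y) \<mapsto> (p, h \<beta> \<alpha> p \<cdot> x, f \<beta> \<alpha> p \<cdot> y)\<close>, which is smooth because the actions and cocycles are.
  Hence the product structures agree on overlaps and glue. The result is Hausdorff because points
  over distinct base points are separated by the projection and points over the same base point lie
  in a common chart; it is second countable because countably many \<open>U \<alpha>\<close> already cover the base.
  The transition maps act on \<open>S\<close> and on \<open>W\<close> separately, so they preserve both families of slices.
\<close>

section \<open>Finite-dimensional normed spaces\<close>

text \<open>Model spaces carry a norm and a finite spanning set, but no inner product and no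
  preferred basis, while smoothness is defined by iterating derivatives along fixed vectors.
  Differentiating a composite yields a derivative along a vector that moves with the point. The
  chain rule therefore needs bounded coordinate functionals, and these come from an induction that
  also yields completeness of finite-dimensional subspaces.

  Atlases are not maximal and inverse charts are \<open>inv_into\<close> terms that depend on the
  chosen domain. Hence smoothness is always settled near a point, and coordinate expressions are
  compared only on open chart images.

  Gluing is kept apart from the quotient: the abstract construction takes subsets of one type, each
  in bijection with a manifold, and knows nothing of bundles. There is a danger of circularity:
  separation of points over different base points needs the projection to be continuous, so
  continuity of maps out of the glued space has to be available before that space is known to be a
  manifold.\<close>

text \<open>The two conclusions are intertwined: completeness of \<open>span b\<close> bounds the
  coordinate along a new vector, and that bound gives completeness of the larger span and controls
  the old coordinates there.\<close>

lemma independent_complete_bounded: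
  fixes b :: "'a::real_normed_vector set"
  assumes "finite b" "independent b"
  shows "complete (span b) \<and>
    (\<forall>i\<in>b. \<exists>K\<ge>0. \<forall>x\<in>span b. \<bar>representation b x i\<bar> \<le> K * norm x)"
  using assms
proof (induction b rule: finite_induct)
  case empty
  then show ?case by (simp add: complete_eq_closed[symmetric] compact_imp_complete)
next
  case (insert a b)
  let ?c = "insert a b"
  have ib: "independent b" and na: "a \<notin> span b"
    using insert.prems insert.hyps independent_insert by metis+
  from insert.IH[OF ib] have compl: "complete (span b)"
    and bd: "\<And>i. i \<in> b \<Longrightarrow> \<exists>K\<ge>0. \<forall>x\<in>span b. \<bar>representation b x i\<bar> \<le> K * norm x" by auto
  have cl: "closed (span b)" using compl by (rule complete_imp_closed)
  \<comment> \<open>\<open>span b\<close> is closed, so \<open>a\<close> has positive distance \<open>d\<close> from it and the coordinate of \<open>y\<close>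
    along \<open>a\<close> is at most \<open>norm y / d\<close>.\<close>
  define d where "d = infdist a (span b)"
  have ne: "span b \<noteq> {}" using span_zero by blast
  have d0: "d > 0"
    unfolding d_def using in_closed_iff_infdist_zero[OF cl ne] na infdist_nonneg[of a "span b"]
    by (metis less_eq_real_def)
  define k where "k y = representation ?c y a" for y
  \<comment> \<open>Removing the \<open>a\<close>-component leaves a vector of
    \<open>span b\<close>, whose coordinates with respect to \<open>b\<close> are the remaining
    coordinates of \<open>y\<close>.\<close>
  have rest: "y - k y *\<^sub>R a \<in> span b"
    and rep: "\<And>i. i \<in> b \<Longrightarrow> representation ?c y i = representation b (y - k y *\<^sub>R a) i"
    if y: "y \<in> span ?c" for y
  proof -
    obtain t where t: "y - t *\<^sub>R a \<in> span b" using y by (auto simp: span_breakdown_eq)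
    have m: "y - t *\<^sub>R a \<in> span ?c" "a \<in> span ?c" "t *\<^sub>R a \<in> span ?c"
      using t span_mono[of b ?c] by (auto simp: span_base span_scale)
    have "representation ?c (y - t *\<^sub>R a + t *\<^sub>R a) = (\<lambda>i. representation ?c (y - t *\<^sub>R a) i
        + representation ?c (t *\<^sub>R a) i)"
      by (rule representation_add[OF insert.prems m(3,1)])
    moreover have "representation ?c (t *\<^sub>R a) = (\<lambda>i. t *\<^sub>R representation ?c a i)"
      using representation_scale[OF insert.prems m(2), of t] by simp
    moreover have "representation ?c a = (\<lambda>i. if i = a then 1 else 0)"
      by (rule representation_basis[OF insert.prems]) simp
    moreover have e: "representation ?c (y - t *\<^sub>R a) = representation b (y - t *\<^sub>R a)"
      by (rule representation_extend[OF insert.prems t]) auto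
    moreover have "representation b (y - t *\<^sub>R a) a = 0"
      using insert.hyps representation_ne_zero by metis
    ultimately have "k y = t" "\<And>i. i \<in> b \<Longrightarrow> representation ?c y i = representation b (y - t *\<^sub>R a) i"
      unfolding k_def using insert.hyps by auto
    then show "y - k y *\<^sub>R a \<in> span b"
      "\<And>i. i \<in> b \<Longrightarrow> representation ?c y i = representation b (y - k y *\<^sub>R a) i"
      using t by auto
  qed
  have kb: "\<bar>k y\<bar> * d \<le> norm y" if y: "y \<in> span ?c" for y
  proof (cases "k y = 0")
    case False
    \<comment> \<open>This element of \<open>span b\<close> equals \<open>a - y / k y\<close>, so
      its distance from \<open>a\<close> is \<open>norm y / \<bar>k y\<bar>\<close>.\<close>
    have "- ((1 / k y) *\<^sub>R (y - k y *\<^sub>R a)) \<in> span b"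
      using rest[OF y] by (intro span_neg span_scale)
    then have "d \<le> dist a (- ((1 / k y) *\<^sub>R (y - k y *\<^sub>R a)))"
      unfolding d_def by (rule infdist_le)
    also have "\<dots> = norm ((1 / k y) *\<^sub>R y)"
      using False by (simp add: dist_norm algebra_simps)
    finally show ?thesis using False by (simp add: field_simps)
  qed (auto simp: )
  have kb': "\<bar>k y\<bar> \<le> norm y / d" if "y \<in> span ?c" for y
    using kb[OF that] d0 by (simp add: field_simps)
  have kdiff: "k (x - y) = k x - k y" if "x \<in> span ?c" "y \<in> span ?c" for x y
    unfolding k_def using representation_diff[OF insert.prems] that by simp
  have "complete (span ?c)"
  proof (rule completeI)
    fix s assume s: "\<forall>n. s n \<in> span ?c" and C: "Cauchy s"
    have Ck: "Cauchy (\<lambda>n. k (s n))"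
    proof (rule CauchyI)
      fix e :: real assume "e > 0"
      \<comment> \<open>The tolerance is \<open>e * d\<close> because \<open>k\<close> is Lipschitz
        with constant \<open>1 / d\<close>.\<close>
      then obtain M where M: "\<And>m n. m \<ge> M \<Longrightarrow> n \<ge> M \<Longrightarrow> norm (s m - s n) < e * d"
        using CauchyD[OF C, of "e * d"] d0 by auto
      have "norm (k (s m) - k (s n)) < e" if "m \<ge> M" "n \<ge> M" for m n
      proof -
        have "norm (k (s m) - k (s n)) \<le> norm (s m - s n) / d"
          using kb'[of "s m - s n"] kdiff s by (simp add: span_diff)
        also have "\<dots> < e" using M[OF that] d0 by (simp add: field_simps)
        finally show ?thesis .
      qed
      then show "\<exists>M. \<forall>m\<ge>M. \<forall>n\<ge>M. norm (k (s m) - k (s n)) < e" by blast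
    qed
    then obtain t where t: "(\<lambda>n. k (s n)) \<longlonglongrightarrow> t"
      using Cauchy_convergent_iff convergent_def by blast
    have ta: "(\<lambda>n. k (s n) *\<^sub>R a) \<longlonglongrightarrow> t *\<^sub>R a" by (intro tendsto_intros t)
    \<comment> \<open>With the \<open>a\<close>-components convergent, the remainders are
      differences of Cauchy sequences and converge in the complete space \<open>span b\<close>;
      adding the two limits gives the limit of \<open>s\<close>.\<close>
    have Cd: "Cauchy (\<lambda>n. s n - k (s n) *\<^sub>R a)"
    proof (rule CauchyI)
      fix e :: real assume "e > 0"
      then have e: "e / 2 > 0" by simp
      obtain M where M: "\<forall>m\<ge>M. \<forall>n\<ge>M. norm (s m - s n) < e / 2"
        using CauchyD[OF C e] by blast
      obtain N where N: "\<forall>m\<ge>N. \<forall>n\<ge>N. norm (k (s m) *\<^sub>R a - k (s n) *\<^sub>R a) < e / 2"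
        using CauchyD[OF LIMSEQ_imp_Cauchy[OF ta] e] by blast
      have "norm ((s m - k (s m) *\<^sub>R a) - (s n - k (s n) *\<^sub>R a)) < e"
        if "m \<ge> max M N" "n \<ge> max M N" for m n
      proof -
        have "norm ((s m - s n) - (k (s m) *\<^sub>R a - k (s n) *\<^sub>R a)) < e / 2 + e / 2"
          using M N that norm_triangle_ineq4[of "s m - s n" "k (s m) *\<^sub>R a - k (s n) *\<^sub>R a"]
          by (smt (verit) max.bounded_iff)
        then show ?thesis by (simp add: algebra_simps)
      qed
      then show "\<exists>M. \<forall>m\<ge>M. \<forall>n\<ge>M.
          norm ((s m - k (s m) *\<^sub>R a) - (s n - k (s n) *\<^sub>R a)) < e" by blast
    qed
    have "\<forall>n. s n - k (s n) *\<^sub>R a \<in> span b" using rest s by simp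
    then obtain l where l: "l \<in> span b" "(\<lambda>n. s n - k (s n) *\<^sub>R a) \<longlonglongrightarrow> l"
      using Cd by (rule completeE[OF compl])
    have "(\<lambda>n. (s n - k (s n) *\<^sub>R a) + k (s n) *\<^sub>R a) \<longlonglongrightarrow> l + t *\<^sub>R a"
      by (intro tendsto_add l ta)
    moreover have "l + t *\<^sub>R a \<in> span ?c"
      by (rule span_add[OF subsetD[OF span_mono l(1)] span_scale[OF span_base]]) auto
    ultimately show "\<exists>l\<in>span ?c. s \<longlonglongrightarrow> l" by auto
  qed
  moreover have "\<exists>K\<ge>0. \<forall>x\<in>span ?c. \<bar>representation ?c x i\<bar> \<le> K * norm x" if "i \<in> ?c" for i
  proof (cases "i = a")
    case True
    have "\<forall>x\<in>span ?c. \<bar>representation ?c x i\<bar> \<le> 1 / d * norm x"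
      using kb' unfolding k_def True by simp
    moreover have "0 \<le> 1 / d" using d0 by simp
    ultimately show ?thesis by blast
  next
    case False
    then have i: "i \<in> b" using that by auto
    then obtain K where K: "K \<ge> 0" "\<forall>x\<in>span b. \<bar>representation b x i\<bar> \<le> K * norm x" using bd by blast
    \<comment> \<open>The factor \<open>1 + norm a / d\<close> bounds the norm of the projection
      that removes the \<open>a\<close>-component; \<open>K\<close> is the bound for coordinate
      \<open>i\<close> on \<open>span b\<close>.\<close>
    have "\<bar>representation ?c x i\<bar> \<le> K * (1 + norm a / d) * norm x" if x: "x \<in> span ?c" for x
    proof -
      have "norm (x - k x *\<^sub>R a) \<le> norm x + \<bar>k x\<bar> * norm a"
        using norm_triangle_ineq4[of x "k x *\<^sub>R a"] by simp
      also have "\<dots> \<le> norm x + norm x / d * norm a"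
        using mult_right_mono[OF kb'[OF x], of "norm a"] by simp
      also have "\<dots> = (1 + norm a / d) * norm x" by (simp add: algebra_simps)
      finally have "K * norm (x - k x *\<^sub>R a) \<le> K * ((1 + norm a / d) * norm x)"
        using K(1) by (rule mult_left_mono)
      moreover have "\<bar>representation ?c x i\<bar> \<le> K * norm (x - k x *\<^sub>R a)"
        using K rep[OF x i] rest[OF x] by simp
      ultimately show ?thesis by (simp add: mult.assoc)
    qed
    then show ?thesis using K(1) d0 by (intro exI[of _ "K * (1 + norm a / d)"]) auto
  qed
  ultimately show ?case by blast
qed

text \<open>A maximal independent subset of the finite spanning set is a basis, and
  \<open>representation\<close> with respect to it is linear on the whole type. Boundedness lets
  these functionals be composed with derivatives.\<close>

lemma finite_dimensional_coordinates:
  assumes "finite_dimensional TYPE('a::real_normed_vector)"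
  obtains b :: "'a::real_normed_vector set" and c :: "'a::real_normed_vector \<Rightarrow> 'a \<Rightarrow> real"
  where "finite b" "\<forall>i\<in>b. bounded_linear (c i)" "\<forall>x. x = (\<Sum>i\<in>b. c i x *\<^sub>R i)"
proof -
  obtain b0 :: "'a set" where b0: "finite b0" "span b0 = UNIV"
    using assms unfolding finite_dimensional_def by blast
  obtain b where b: "b \<subseteq> b0" "independent b" "b0 \<subseteq> span b"
    using maximal_independent_subset by blast
  have fb: "finite b" using b b0 finite_subset by blast
  have sb: "span b = UNIV" using b b0 by (metis span_mono span_span top.extremum_uniqueI)
  let ?c = "\<lambda>i x. representation b x i"
  have "bounded_linear (?c i)" if i: "i \<in> b" for i
  proof -
    obtain K where "\<forall>x. \<bar>representation b x i\<bar> \<le> K * norm x"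
      using independent_complete_bounded[OF fb b(2)] i sb by auto
    then show ?thesis
      by (intro bounded_linear_intro[where K = K])
        (auto simp: representation_add[OF b(2)] representation_scale[OF b(2)] sb mult.commute)
  qed
  moreover have "x = (\<Sum>i\<in>b. ?c i x *\<^sub>R i)" for x
    using sum_representation_eq[OF b(2), of x b] sb fb by simp
  ultimately show thesis using that[OF fb, of ?c] by simp
qed

lemma finite_dimensional_prod:
  assumes "finite_dimensional TYPE('a::real_vector)" "finite_dimensional TYPE('b::real_vector)"
  shows "finite_dimensional TYPE('a::real_vector \<times> 'b::real_vector)"
proof -
  obtain a :: "'a set" and b :: "'b set" where ab: "finite a" "span a = UNIV" "finite b" "span b = UNIV"
    using assms unfolding finite_dimensional_def by blast
  let ?c = "(\<lambda>x. (x, 0)) ` a \<union> (\<lambda>y. (0, y)) ` b"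
  have l: "linear (\<lambda>x. (x, 0::'b))" "linear (\<lambda>y. (0::'a, y))" by (auto intro: linearI)
  have "(x, y) \<in> span ?c" for x y
  proof -
    have "(x, 0) \<in> span ?c"
      using ab(2) linear_span_image[OF l(1), of a] span_mono[of "(\<lambda>x. (x, 0)) ` a" ?c] by blast
    moreover have "(0, y) \<in> span ?c"
      using ab(4) linear_span_image[OF l(2), of b] span_mono[of "(\<lambda>y. (0, y)) ` b" ?c] by blast
    ultimately show ?thesis using span_add[of "(x, 0)" ?c "(0, y)"] by simp
  qed
  then have "span ?c = UNIV" by auto
  moreover have "finite ?c" using ab by simp
  ultimately show ?thesis unfolding finite_dimensional_def by blast
qed

section \<open>Calculus of smooth maps\<close>

lemma Ck_on_subset: "Ck_on k U f \<Longrightarrow> V \<subseteq> U \<Longrightarrow> Ck_on k V f"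
  by (induction k arbitrary: f) (auto intro: continuous_on_subset)

lemma Ck_on_SucD:
  assumes "Ck_on (Suc k) U f"
  shows "\<exists>f'. (\<forall>x\<in>U. (f has_derivative f' x) (at x)) \<and> (\<forall>v. Ck_on k U (\<lambda>x. f' x v))"
  using assms by (intro exI[of _ "\<lambda>x. frechet_derivative f (at x)"])
    (simp add: frechet_derivative_works)

text \<open>On an open set, agreement at all points is agreement near each point, so the derivatives
  agree as well and the induction can continue with them.\<close>

lemma Ck_on_cong:
  assumes "open U" "\<And>x. x \<in> U \<Longrightarrow> f x = g x" "Ck_on k U f"
  shows "Ck_on k U g"
  using assms(2,3)
proof (induction k arbitrary: f g)
  case 0
  then show ?case using continuous_on_cong by fastforce
next
  case (Suc k)
  have d: "g differentiable (at x)"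
    "frechet_derivative f (at x) = frechet_derivative g (at x)" if "x \<in> U" for x
  proof -
    have "(f has_derivative frechet_derivative f (at x)) (at x)"
      using Suc.prems(2) that by (simp add: frechet_derivative_works)
    then have "(g has_derivative frechet_derivative f (at x)) (at x)"
      by (rule has_derivative_transform_within_open[OF _ assms(1) that]) (simp add: Suc.prems(1))
    then show "g differentiable (at x)"
      "frechet_derivative f (at x) = frechet_derivative g (at x)"
      using frechet_derivative_at by (auto simp: differentiable_def)
  qed
  have "Ck_on k U (\<lambda>x. frechet_derivative g (at x) v)" for v
    by (rule Suc.IH[of "\<lambda>x. frechet_derivative f (at x) v"]) (use d Suc.prems(2) in auto)
  then show ?case using d by auto
qed

text \<open>Together with \<open>Ck_on_SucD\<close> this hides the chosen
  \<open>frechet_derivative\<close>: by uniqueness of derivatives any family \<open>f'\<close> may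
  be exhibited. It need agree with the chosen one only on \<open>U\<close>, hence the detour through
  \<open>Ck_on_cong\<close>.\<close>

lemma Ck_on_SucI:
  assumes "open U" "\<And>x. x \<in> U \<Longrightarrow> (f has_derivative f' x) (at x)"
    "\<And>v. Ck_on k U (\<lambda>x. f' x v)"
  shows "Ck_on (Suc k) U f"
proof -
  have "f' x = frechet_derivative f (at x)" if "x \<in> U" for x
    using assms(2)[OF that] by (rule frechet_derivative_at)
  then have "Ck_on k U (\<lambda>x. frechet_derivative f (at x) v)" for v
    using Ck_on_cong[OF assms(1) _ assms(3)[of v]] by simp
  moreover have "f differentiable (at x)" if "x \<in> U" for x
    using assms(2)[OF that] by (rule differentiableI)
  ultimately show ?thesis by simp
qed

lemma Ck_on_Suc_imp: "Ck_on (Suc k) U f \<Longrightarrow> Ck_on k U f"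
proof (induction k arbitrary: f)
  case 0
  then have "f differentiable (at x within U)" if "x \<in> U" for x
    using that by (simp add: differentiable_at_withinI)
  then show ?case
    by (simp add: differentiable_imp_continuous_on differentiable_on_def)
next
  case (Suc k)
  have "f differentiable (at x)" if "x \<in> U" for x
    using Suc.prems that by simp
  moreover have "Ck_on k U (\<lambda>x. frechet_derivative f (at x) v)" for v
    by (rule Suc.IH) (use Suc.prems in \<open>subst (asm) Ck_on.simps(2), blast\<close>)
  ultimately show ?case by simp
qed

lemma Ck_on_const: "open U \<Longrightarrow> Ck_on k U (\<lambda>x. c)"
proof (induction k arbitrary: c)
  case (Suc k)
  then show ?case by (intro Ck_on_SucI[where f' = "\<lambda>x v. 0"] has_derivative_const)
qed simp

lemma Ck_on_add:
  assumes "open U"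
  shows "Ck_on k U f \<Longrightarrow> Ck_on k U g \<Longrightarrow> Ck_on k U (\<lambda>x. f x + g x)"
proof (induction k arbitrary: f g)
  case 0
  then show ?case by (auto intro: continuous_on_add)
next
  case (Suc k)
  obtain f' where f': "\<forall>x\<in>U. (f has_derivative f' x) (at x)" "\<forall>v. Ck_on k U (\<lambda>x. f' x v)"
    using Ck_on_SucD[OF Suc.prems(1)] by blast
  obtain g' where g': "\<forall>x\<in>U. (g has_derivative g' x) (at x)" "\<forall>v. Ck_on k U (\<lambda>x. g' x v)"
    using Ck_on_SucD[OF Suc.prems(2)] by blast
  show ?case
    by (rule Ck_on_SucI[OF assms, where f' = "\<lambda>x v. f' x v + g' x v"])
      (simp_all add: has_derivative_add f' g' Suc.IH)
qed

lemma Ck_on_sum: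
  assumes "open U" "\<And>i. i \<in> I \<Longrightarrow> Ck_on k U (f i)"
  shows "Ck_on k U (\<lambda>x. \<Sum>i\<in>I. f i x)"
  using assms(2)
  by (induction I rule: infinite_finite_induct) (auto simp: Ck_on_const assms(1) intro!: Ck_on_add)

text \<open>The product rule keeps one factor undifferentiated in each term, so the induction
  hypothesis is also applied to \<open>f\<close> and \<open>g\<close> themselves, one order
  lower.\<close>

lemma Ck_on_scaleR:
  assumes "open U"
  shows "Ck_on k U f \<Longrightarrow> Ck_on k U g \<Longrightarrow> Ck_on k U (\<lambda>x. f x *\<^sub>R g x)"
proof (induction k arbitrary: f g)
  case 0
  then show ?case by (auto intro: continuous_on_scaleR)
next
  case (Suc k)
  obtain f' where f': "\<forall>x\<in>U. (f has_derivative f' x) (at x)" "\<forall>v. Ck_on k U (\<lambda>x. f' x v)"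
    using Ck_on_SucD[OF Suc.prems(1)] by blast
  obtain g' where g': "\<forall>x\<in>U. (g has_derivative g' x) (at x)" "\<forall>v. Ck_on k U (\<lambda>x. g' x v)"
    using Ck_on_SucD[OF Suc.prems(2)] by blast
  have "Ck_on k U f" "Ck_on k U g" using Suc.prems by (auto intro: Ck_on_Suc_imp)
  then show ?case
    by (intro Ck_on_SucI[OF assms, where f' = "\<lambda>x v. f x *\<^sub>R g' x v + f' x v *\<^sub>R g x"]
        has_derivative_scaleR Ck_on_add[OF assms] Suc.IH f'[rule_format] g'[rule_format])
qed

lemma Ck_on_bounded_linear_comp:
  assumes "open U" "bounded_linear L"
  shows "Ck_on k U f \<Longrightarrow> Ck_on k U (\<lambda>x. L (f x))"
proof (induction k arbitrary: f)
  case 0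
  then show ?case by (simp add: bounded_linear.continuous_on[OF assms(2)])
next
  case (Suc k)
  obtain f' where f': "\<forall>x\<in>U. (f has_derivative f' x) (at x)" "\<forall>v. Ck_on k U (\<lambda>x. f' x v)"
    using Ck_on_SucD[OF Suc.prems(1)] by blast
  show ?case
    by (intro Ck_on_SucI[OF assms(1), where f' = "\<lambda>x v. L (f' x v)"] Suc.IH f'[rule_format]
        bounded_linear.has_derivative[OF assms(2)])
qed

lemma Ck_on_bounded_linear:
  assumes "open U" "bounded_linear L"
  shows "Ck_on k U L"
proof (cases k)
  case 0
  then show ?thesis by (simp add: linear_continuous_on assms(2))
next
  case (Suc n)
  show ?thesis unfolding Suc
    by (intro Ck_on_SucI[OF assms(1), where f' = "\<lambda>x. L"] Ck_on_const assms
        bounded_linear_imp_has_derivative)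
qed

text \<open>The induction varies \<open>f\<close> but keeps \<open>g\<close>: derivatives of the
  composite are combinations of directional derivatives of \<open>f\<close> along basis vectors,
  each composed with the same \<open>g\<close>.\<close>

lemma Ck_on_compose:
  fixes f :: "'e::real_normed_vector \<Rightarrow> 'g::real_normed_vector"
    and g :: "'d::real_normed_vector \<Rightarrow> 'e"
  assumes "finite_dimensional TYPE('e)" "open U" "open V" "g ` U \<subseteq> V"
  shows "Ck_on k U g \<Longrightarrow> Ck_on k V f \<Longrightarrow> Ck_on k U (\<lambda>x. f (g x))"
proof (induction k arbitrary: f)
  case 0
  then show ?case using continuous_on_compose2[OF _ _ assms(4)] by simp
next
  case (Suc k)
  obtain b :: "'e set" and c :: "'e \<Rightarrow> 'e \<Rightarrow> real" where b: "finite b"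
    "\<forall>i\<in>b. bounded_linear (c i)" "\<forall>x. x = (\<Sum>i\<in>b. c i x *\<^sub>R i)"
    using finite_dimensional_coordinates[OF assms(1)] .
  obtain f' where f': "\<forall>x\<in>V. (f has_derivative f' x) (at x)" "\<forall>v. Ck_on k V (\<lambda>x. f' x v)"
    using Ck_on_SucD[OF Suc.prems(2)] by blast
  obtain g' where g': "\<forall>x\<in>U. (g has_derivative g' x) (at x)" "\<forall>v. Ck_on k U (\<lambda>x. g' x v)"
    using Ck_on_SucD[OF Suc.prems(1)] by blast
  have gk: "Ck_on k U g" using Suc.prems(1) by (rule Ck_on_Suc_imp)
  \<comment> \<open>\<open>Ck_on\<close> controls \<open>f'\<close> only along fixed vectors, so the moving vector \<open>g' x v\<close> is expanded
    in a basis; this is where finite dimension enters.\<close>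
  let ?D = "\<lambda>x v. \<Sum>i\<in>b. c i (g' x v) *\<^sub>R f' (g x) i"
  show ?case
  proof (rule Ck_on_SucI[where f' = ?D])
    fix x assume x: "x \<in> U"
    then have gx: "g x \<in> V" using assms(4) by auto
    interpret L: bounded_linear "f' (g x)" using bspec[OF f'(1) gx] by (rule has_derivative_bounded_linear)
    have "f' (g x) (g' x v) = ?D x v" for v
      by (subst b(3)[rule_format, of "g' x v"]) (simp add: L.sum L.scaleR)
    then have "f' (g x) \<circ> g' x = ?D x" by (simp add: fun_eq_iff)
    then show "((\<lambda>x. f (g x)) has_derivative ?D x) (at x)"
      using diff_chain_at[OF bspec[OF g'(1) x] bspec[OF f'(1) gx]] by (simp add: comp_def)
  next
    fix v
    show "Ck_on k U (\<lambda>x. ?D x v)"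
    proof (rule Ck_on_sum[OF assms(2)])
      fix i assume i: "i \<in> b"
      have "Ck_on k U (\<lambda>x. c i (g' x v))"
        using Ck_on_bounded_linear_comp[OF assms(2) bspec[OF b(2) i]] g'(2) by blast
      moreover have "Ck_on k U (\<lambda>x. f' (g x) i)"
        using Suc.IH[OF gk, of "\<lambda>y. f' y i"] f'(2) by blast
      ultimately show "Ck_on k U (\<lambda>x. c i (g' x v) *\<^sub>R f' (g x) i)"
        by (rule Ck_on_scaleR[OF assms(2)])
    qed
  qed (rule assms)
qed

text \<open>Derivatives are taken \<open>at x\<close>, without reference to a domain, so the
  condition is local at every order. This lets a coordinate expression be checked with an auxiliary
  chart chosen for each point.\<close>

lemma Ck_on_locally:
  assumes "\<And>x. x \<in> U \<Longrightarrow> \<exists>N. open N \<and> x \<in> N \<and> Ck_on k N f"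
  shows "Ck_on k U f"
  using assms
proof (induction k arbitrary: f)
  case 0
  have "isCont f x" if "x \<in> U" for x
    using 0[OF that] continuous_on_eq_continuous_at by auto
  then show ?case by (simp add: continuous_at_imp_continuous_on)
next
  case (Suc k)
  show ?case unfolding Ck_on.simps
  proof (intro conjI allI ballI)
    show "f differentiable (at x)" if "x \<in> U" for x
      using Suc.prems[OF that] by auto
    show "Ck_on k U (\<lambda>x. frechet_derivative f (at x) v)" for v
    proof (rule Suc.IH)
      fix x assume "x \<in> U"
      from Suc.prems[OF this]
      show "\<exists>N. open N \<and> x \<in> N \<and> Ck_on k N (\<lambda>x. frechet_derivative f (at x) v)" by auto
    qed
  qed
qed

lemma smooth_on_subset: "smooth_on U f \<Longrightarrow> V \<subseteq> U \<Longrightarrow> smooth_on V f"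
  unfolding smooth_on_def using Ck_on_subset by blast

lemma smooth_on_cong:
  "open U \<Longrightarrow> (\<And>x. x \<in> U \<Longrightarrow> f x = g x) \<Longrightarrow> smooth_on U f \<Longrightarrow> smooth_on U g"
  unfolding smooth_on_def using Ck_on_cong[of U f g] by simp

lemma smooth_on_compose:
  fixes f :: "'e::real_normed_vector \<Rightarrow> 'g::real_normed_vector"
    and g :: "'d::real_normed_vector \<Rightarrow> 'e"
  assumes "finite_dimensional TYPE('e)" "open U" "open V" "g ` U \<subseteq> V" "smooth_on U g" "smooth_on V f"
  shows "smooth_on U (\<lambda>x. f (g x))"
  using assms Ck_on_compose[OF assms(1-4)] unfolding smooth_on_def by blast

lemma smooth_on_locally:
  "(\<And>x. x \<in> U \<Longrightarrow> \<exists>N. open N \<and> x \<in> N \<and> smooth_on N f) \<Longrightarrow> smooth_on U f"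
  unfolding smooth_on_def by (rule allI, rule Ck_on_locally) blast

lemma smooth_on_bounded_linear: "open U \<Longrightarrow> bounded_linear L \<Longrightarrow> smooth_on U L"
  unfolding smooth_on_def using Ck_on_bounded_linear by blast

text \<open>A pair is the sum of its images under the two linear inclusions of the factors, which
  replaces a further induction.\<close>

lemma smooth_on_Pair:
  assumes "open U" "smooth_on U f" "smooth_on U g"
  shows "smooth_on U (\<lambda>x. (f x, g x))"
proof -
  have "Ck_on k U (\<lambda>x. (f x, 0) + (0, g x))" for k
    using assms by (intro Ck_on_add Ck_on_bounded_linear_comp[of U "\<lambda>y. (y, 0)"]
        Ck_on_bounded_linear_comp[of U "\<lambda>y. (0, y)"] bounded_linear_Pair
        bounded_linear_ident bounded_linear_zero) (simp_all add: smooth_on_def)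
  then show ?thesis unfolding smooth_on_def by simp
qed

section \<open>Charts and smooth maps between manifolds\<close>

text \<open>Since \<open>V\<close> and its image are both open, relative openness is openness. This
  form avoids subspace topologies and splits the homeomorphism into injectivity, openness and
  continuity, which are checked separately for restrictions, products and glued charts.\<close>

lemma is_chart_iff:
  "is_chart T V \<psi> \<longleftrightarrow> openin T V \<and> inj_on \<psi> V \<and>
    (\<forall>N. openin T N \<longrightarrow> N \<subseteq> V \<longrightarrow> open (\<psi> ` N)) \<and> (\<forall>G. open G \<longrightarrow> openin T (V \<inter> \<psi> -` G))"
  (is "?L \<longleftrightarrow> ?R")
proof
  assume L: ?L
  then have V: "openin T V" and o: "open (\<psi> ` V)"
    and h: "homeomorphic_map (subtopology T V) (top_of_set (\<psi> ` V)) \<psi>"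
    by (auto simp: is_chart_def)
  have ts: "topspace (subtopology T V) = V"
    using V openin_subset by (fastforce simp: topspace_subtopology)
  have "inj_on \<psi> V" using homeomorphic_imp_injective_map[OF h] ts by simp
  moreover have "open (\<psi> ` N)" if "openin T N" "N \<subseteq> V" for N
  proof -
    have "openin (subtopology T V) N" using that V by (simp add: openin_open_subtopology)
    then have "openin (top_of_set (\<psi> ` V)) (\<psi> ` N)"
      using homeomorphic_imp_open_map[OF h] by (simp add: open_map_def)
    then show ?thesis using o openin_open_trans by blast
  qed
  moreover have "openin T (V \<inter> \<psi> -` G)" if "open G" for G
  proof -
    have "openin (top_of_set (\<psi> ` V)) (\<psi> ` V \<inter> G)" using that by (rule openin_open_Int)
    then have "openin (subtopology T V) {x \<in> V. \<psi> x \<in> \<psi> ` V \<inter> G}"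
      using openin_continuous_map_preimage[OF homeomorphic_imp_continuous_map[OF h]] ts by fastforce
    moreover have "{x \<in> V. \<psi> x \<in> \<psi> ` V \<inter> G} = V \<inter> \<psi> -` G" by auto
    ultimately show ?thesis using V by (simp add: openin_open_subtopology)
  qed
  ultimately show ?R using V by blast
next
  assume R: ?R
  then have V: "openin T V" and o: "open (\<psi> ` V)" and i: "inj_on \<psi> V"
    and 1: "\<And>N. openin T N \<Longrightarrow> N \<subseteq> V \<Longrightarrow> open (\<psi> ` N)"
    and 2: "\<And>G. open G \<Longrightarrow> openin T (V \<inter> \<psi> -` G)" by auto
  have ts: "topspace (subtopology T V) = V"
    using V openin_subset by (fastforce simp: topspace_subtopology)
  have "homeomorphic_map (subtopology T V) (top_of_set (\<psi> ` V)) \<psi>"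
  proof (rule bijective_open_imp_homeomorphic_map)
    show "continuous_map (subtopology T V) (top_of_set (\<psi> ` V)) \<psi>"
      unfolding continuous_map ts
    proof (intro conjI allI impI)
      fix Q assume "openin (top_of_set (\<psi> ` V)) Q"
      then obtain G where G: "open G" "Q = \<psi> ` V \<inter> G" by (auto simp: openin_open)
      have "{x \<in> V. \<psi> x \<in> Q} = V \<inter> \<psi> -` G" unfolding G(2) by auto
      then show "openin (subtopology T V) {x \<in> V. \<psi> x \<in> Q}"
        using 2[OF G(1)] V by (simp add: openin_open_subtopology)
    qed auto
    show "open_map (subtopology T V) (top_of_set (\<psi> ` V)) \<psi>"
      unfolding open_map_def
    proof (intro allI impI)
      fix N assume "openin (subtopology T V) N"
      then have N: "openin T N" "N \<subseteq> V" using V by (simp_all add: openin_open_subtopology)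
      show "openin (top_of_set (\<psi> ` V)) (\<psi> ` N)"
        by (rule open_subset[OF image_mono[OF N(2)] 1[OF N]])
    qed
  qed (simp_all only: ts i topspace_euclidean_subtopology)
  then show ?L using V o by (simp add: is_chart_def)
qed

lemma is_chart_Int_open:
  assumes "is_chart T V \<psi>" "openin T U"
  shows "is_chart (subtopology T U) (V \<inter> U) \<psi>"
proof -
  have V: "openin T V" "inj_on \<psi> V"
    and 1: "\<And>N. openin T N \<Longrightarrow> N \<subseteq> V \<Longrightarrow> open (\<psi> ` N)"
    and 2: "\<And>G. open G \<Longrightarrow> openin T (V \<inter> \<psi> -` G)"
    using assms(1) by (simp_all add: is_chart_iff)
  have "openin T (V \<inter> U \<inter> \<psi> -` G)" if "open G" for G
    using openin_Int[OF 2[OF that] assms(2)] by (simp add: Int_ac)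
  then show ?thesis
    using V 1 assms(2)
    by (auto simp: is_chart_iff openin_open_subtopology intro: inj_on_subset)
qed

lemma openin_prod_topologyE:
  assumes "openin (prod_topology S T) N" "(x, y) \<in> N"
  obtains P Q where "openin S P" "openin T Q" "x \<in> P" "y \<in> Q" "P \<times> Q \<subseteq> N"
  using assms(1)[unfolded openin_prod_topology_alt, rule_format, OF assms(2)] by (elim exE conjE)

text \<open>Open rectangles are a base both for the abstract \<open>prod_topology\<close> and for
  the product of model spaces, and \<open>map_prod\<close> respects rectangles in both
  directions.\<close>

lemma is_chart_prod:
  assumes "is_chart S V \<psi>" "is_chart T V' \<psi>'"
  shows "is_chart (prod_topology S T) (V \<times> V') (map_prod \<psi> \<psi>')"
  unfolding is_chart_iff
proof (intro conjI allI impI)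
  have V: "openin S V" "inj_on \<psi> V"
    and 1: "\<And>N. openin S N \<Longrightarrow> N \<subseteq> V \<Longrightarrow> open (\<psi> ` N)"
    and 2: "\<And>G. open G \<Longrightarrow> openin S (V \<inter> \<psi> -` G)"
    using assms(1) by (simp_all add: is_chart_iff)
  have V': "openin T V'" "inj_on \<psi>' V'"
    and 3: "\<And>N. openin T N \<Longrightarrow> N \<subseteq> V' \<Longrightarrow> open (\<psi>' ` N)"
    and 4: "\<And>G. open G \<Longrightarrow> openin T (V' \<inter> \<psi>' -` G)"
    using assms(2) by (simp_all add: is_chart_iff)
  show "openin (prod_topology S T) (V \<times> V')" using V V' by (simp add: openin_prod_Times_iff)
  show "inj_on (map_prod \<psi> \<psi>') (V \<times> V')" using V V' by (simp add: map_prod_inj_on)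
  show "open (map_prod \<psi> \<psi>' ` N)" if N: "openin (prod_topology S T) N" "N \<subseteq> V \<times> V'" for N
    unfolding open_prod_def
  proof
    fix z assume "z \<in> map_prod \<psi> \<psi>' ` N"
    then obtain x y where xy: "(x, y) \<in> N" "z = (\<psi> x, \<psi>' y)" by auto
    obtain P Q where PQ: "openin S P" "openin T Q" "x \<in> P" "y \<in> Q" "P \<times> Q \<subseteq> N"
      by (rule openin_prod_topologyE[OF N(1) xy(1)])
    have "P \<times> Q \<subseteq> V \<times> V'" using PQ(5) N(2) by blast
    then have "P \<subseteq> V" "Q \<subseteq> V'" using PQ(3,4) by auto
    then have "open (\<psi> ` P)" "open (\<psi>' ` Q)" using 1[OF PQ(1)] 3[OF PQ(2)] by simp_all
    moreover have "z \<in> \<psi> ` P \<times> \<psi>' ` Q" using xy PQ by blast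
    moreover have "\<psi> ` P \<times> \<psi>' ` Q \<subseteq> map_prod \<psi> \<psi>' ` N"
      using image_mono[OF PQ(5), of "map_prod \<psi> \<psi>'"] by (simp add: map_prod_surj_on)
    ultimately show "\<exists>A B. open A \<and> open B \<and> z \<in> A \<times> B \<and> A \<times> B \<subseteq> map_prod \<psi> \<psi>' ` N" by blast
  qed
  show "openin (prod_topology S T) (V \<times> V' \<inter> map_prod \<psi> \<psi>' -` G)" if "open G" for G
    unfolding openin_prod_topology_alt
  proof (intro allI impI)
    fix x y assume xy: "(x, y) \<in> V \<times> V' \<inter> map_prod \<psi> \<psi>' -` G"
    then have "(\<psi> x, \<psi>' y) \<in> G" by simp
    then obtain P Q where PQ: "open P" "open Q" "\<psi> x \<in> P" "\<psi>' y \<in> Q" "P \<times> Q \<subseteq> G"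
      using \<open>open G\<close> by (metis open_prod_elim mem_Sigma_iff)
    have "(V \<inter> \<psi> -` P) \<times> (V' \<inter> \<psi>' -` Q) \<subseteq> V \<times> V' \<inter> map_prod \<psi> \<psi>' -` G"
      using PQ(5) by auto
    moreover have "x \<in> V \<inter> \<psi> -` P" "y \<in> V' \<inter> \<psi>' -` Q" using xy PQ by auto
    ultimately show "\<exists>U W. openin S U \<and> openin T W \<and> x \<in> U \<and> y \<in> W \<and>
        U \<times> W \<subseteq> V \<times> V' \<inter> map_prod \<psi> \<psi>' -` G"
      using 2[OF PQ(1)] 4[OF PQ(2)] by blast
  qed
qed

lemma second_countable_prod_topology:
  assumes "second_countable S" "second_countable T"
  shows "second_countable (prod_topology S T)"
proof -
  obtain \<B> where B: "countable \<B>" "\<forall>V\<in>\<B>. openin S V"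
    "\<forall>U x. openin S U \<and> x \<in> U \<longrightarrow> (\<exists>V\<in>\<B>. x \<in> V \<and> V \<subseteq> U)"
    using assms(1) unfolding second_countable_def by blast
  obtain \<C> where C: "countable \<C>" "\<forall>V\<in>\<C>. openin T V"
    "\<forall>U x. openin T U \<and> x \<in> U \<longrightarrow> (\<exists>V\<in>\<C>. x \<in> V \<and> V \<subseteq> U)"
    using assms(2) unfolding second_countable_def by blast
  let ?D = "(\<lambda>(P, Q). P \<times> Q) ` (\<B> \<times> \<C>)"
  show ?thesis
    unfolding second_countable_def
  proof (intro exI[of _ ?D] conjI allI impI)
    show "countable ?D" using B(1) C(1) by simp
    show "\<forall>V\<in>?D. openin (prod_topology S T) V" using B(2) C(2) by (auto simp: openin_prod_Times_iff)
    fix U z assume "openin (prod_topology S T) U \<and> z \<in> U"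
    moreover obtain x y where z: "z = (x, y)" by (cases z)
    ultimately have "openin (prod_topology S T) U" "(x, y) \<in> U" by simp_all
    then obtain P Q where PQ: "openin S P" "openin T Q" "x \<in> P" "y \<in> Q" "P \<times> Q \<subseteq> U"
      by (rule openin_prod_topologyE)
    obtain P' where P': "P' \<in> \<B>" "x \<in> P'" "P' \<subseteq> P" using B(3) PQ by blast
    obtain Q' where Q': "Q' \<in> \<C>" "y \<in> Q'" "Q' \<subseteq> Q" using C(3) PQ by blast
    have "P' \<times> Q' \<in> ?D" using P' Q' by force
    moreover have "z \<in> P' \<times> Q'" "P' \<times> Q' \<subseteq> U" using P' Q' PQ z by auto
    ultimately show "\<exists>V\<in>?D. z \<in> V \<and> V \<subseteq> U" by blast
  qed
qed

section \<open>Access to charts and coordinate expressions\<close>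

lemma smooth_manifoldI:
  assumes "finite_dimensional TYPE('e::real_normed_vector)"
    and "Hausdorff_space (top_of X)" "second_countable (top_of X)"
    and "\<And>V \<psi>. (V, \<psi>) \<in> charts X \<Longrightarrow> is_chart (top_of X) V \<psi>"
    and "(\<Union>(V, \<psi>) \<in> charts X. V) = pts X"
    and "\<And>V \<psi> V' \<psi>'. (V, \<psi>) \<in> charts X \<Longrightarrow> (V', \<psi>') \<in> charts X \<Longrightarrow>
      smooth_on (\<psi> ` (V \<inter> V')) (\<psi>' \<circ> inv_into V \<psi>)"
  shows "smooth_manifold (X :: ('a, 'e::real_normed_vector) mfd)"
  unfolding smooth_manifold_def by (intro conjI ballI case_prodI2 assms) simp_all

lemma
  assumes "smooth_manifold (X :: ('a, 'e::real_normed_vector) mfd)"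
  shows smooth_manifold_finite_dimensional: "finite_dimensional TYPE('e::real_normed_vector)"
    and smooth_manifold_Hausdorff: "Hausdorff_space (top_of X)"
    and smooth_manifold_second_countable: "second_countable (top_of X)"
    and smooth_manifold_cover: "(\<Union>(V, \<psi>) \<in> charts X. V) = pts X"
  using assms unfolding smooth_manifold_def by simp_all

lemma smooth_manifold_chart:
  assumes "smooth_manifold X" "(V, \<psi>) \<in> charts X"
  shows "is_chart (top_of X) V \<psi>"
proof -
  have "\<forall>(V, \<psi>) \<in> charts X. is_chart (top_of X) V \<psi>"
    using assms(1) unfolding smooth_manifold_def by simp
  from bspec[OF this assms(2)] show ?thesis by simp
qed

lemma smooth_manifold_transition:
  assumes "smooth_manifold X" "(V, \<psi>) \<in> charts X" "(V', \<psi>') \<in> charts X"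
  shows "smooth_on (\<psi> ` (V \<inter> V')) (\<psi>' \<circ> inv_into V \<psi>)"
proof -
  have "\<forall>(V, \<psi>) \<in> charts X. \<forall>(V', \<psi>') \<in> charts X.
      smooth_on (\<psi> ` (V \<inter> V')) (\<psi>' \<circ> inv_into V \<psi>)"
    using assms(1) unfolding smooth_manifold_def by simp
  from bspec[OF bspec[OF this assms(2), simplified] assms(3)] show ?thesis by simp
qed

lemma
  assumes "smooth_manifold X" "(V, \<psi>) \<in> charts X"
  shows chart_openin: "openin (top_of X) V"
    and chart_inj: "inj_on \<psi> V"
    and chart_image_open: "openin (top_of X) N \<Longrightarrow> N \<subseteq> V \<Longrightarrow> open (\<psi> ` N)"
    and chart_vimage_open: "open G \<Longrightarrow> openin (top_of X) (V \<inter> \<psi> -` G)"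
    and chart_subset: "V \<subseteq> pts X"
    and chart_inv: "x \<in> V \<Longrightarrow> inv_into V \<psi> (\<psi> x) = x"
  using smooth_manifold_chart[OF assms] openin_subset[of "top_of X" V]
  by (auto simp: is_chart_iff)

lemma chart_at:
  assumes "smooth_manifold X" "x \<in> pts X"
  obtains V \<psi> where "(V, \<psi>) \<in> charts X" "x \<in> V"
  using assms smooth_manifold_cover[OF assms(1)] by blast

lemma smooth_mapI:
  assumes "continuous_map (top_of X) (top_of Y) f"
    and "\<And>V \<psi> V' \<psi>'. (V, \<psi>) \<in> charts X \<Longrightarrow> (V', \<psi>') \<in> charts Y \<Longrightarrow>
      smooth_on (\<psi> ` (V \<inter> f -` V')) (\<psi>' \<circ> f \<circ> inv_into V \<psi>)"
  shows "smooth_map X Y f"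
  unfolding smooth_map_def by (intro conjI ballI case_prodI2 assms) simp_all

lemma
  assumes "smooth_map X Y f"
  shows smooth_map_continuous: "continuous_map (top_of X) (top_of Y) f"
    and smooth_map_pts: "x \<in> pts X \<Longrightarrow> f x \<in> pts Y"
  using assms unfolding smooth_map_def continuous_map_def by auto

lemma smooth_map_in_charts:
  assumes "smooth_map X Y f" "(V, \<psi>) \<in> charts X" "(V', \<psi>') \<in> charts Y"
  shows "smooth_on (\<psi> ` (V \<inter> f -` V')) (\<psi>' \<circ> f \<circ> inv_into V \<psi>)"
proof -
  have "\<forall>(V, \<psi>) \<in> charts X. \<forall>(V', \<psi>') \<in> charts Y.
      smooth_on (\<psi> ` (V \<inter> f -` V')) (\<psi>' \<circ> f \<circ> inv_into V \<psi>)"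
    using assms(1) unfolding smooth_map_def by simp
  from bspec[OF bspec[OF this assms(2), simplified] assms(3)] show ?thesis by simp
qed

lemma openin_Int_vimage:
  assumes "continuous_map T T' f" "openin T V" "openin T' V'"
  shows "openin T (V \<inter> f -` V')"
proof -
  have "V \<inter> f -` V' = {x \<in> V. f x \<in> V'}" by auto
  then show ?thesis using openin_continuous_map_preimage_gen[OF assms] by simp
qed

text \<open>Expressions containing different \<open>inv_into\<close> terms are compared only at
  points \<open>\<psi> x\<close>, where the inverse can be evaluated; away from the chart image they
  may differ.\<close>

lemma smooth_on_image_cong:
  assumes "open (\<psi> ` N)" "smooth_on (\<psi> ` N) F" "\<And>x. x \<in> N \<Longrightarrow> F (\<psi> x) = G (\<psi> x)"
  shows "smooth_on (\<psi> ` N) G"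
  by (rule smooth_on_cong[OF assms(1) _ assms(2)]) (use assms(3) in auto)

lemma smooth_map_cong:
  assumes "smooth_manifold X" "smooth_manifold Y" "smooth_map X Y f" "\<And>x. x \<in> pts X \<Longrightarrow> f x = g x"
  shows "smooth_map X Y g"
proof (rule smooth_mapI)
  show "continuous_map (top_of X) (top_of Y) g"
    using continuous_map_eq[OF smooth_map_continuous[OF assms(3)]] assms(4) by blast
  fix V \<psi> V' \<psi>' assume c: "(V, \<psi>) \<in> charts X" "(V', \<psi>') \<in> charts Y"
  have e: "V \<inter> g -` V' = V \<inter> f -` V'" using assms(4) chart_subset[OF assms(1) c(1)] by auto
  show "smooth_on (\<psi> ` (V \<inter> g -` V')) (\<psi>' \<circ> g \<circ> inv_into V \<psi>)"
    unfolding e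
  proof (rule smooth_on_image_cong[OF _ smooth_map_in_charts[OF assms(3) c]])
    show "open (\<psi> ` (V \<inter> f -` V'))"
      using chart_image_open[OF assms(1) c(1) openin_Int_vimage[OF smooth_map_continuous[OF assms(3)]
            chart_openin[OF assms(1) c(1)] chart_openin[OF assms(2) c(2)]]] by simp
    fix x assume "x \<in> V \<inter> f -` V'"
    then show "(\<psi>' \<circ> f \<circ> inv_into V \<psi>) (\<psi> x) = (\<psi>' \<circ> g \<circ> inv_into V \<psi>) (\<psi> x)"
      using chart_inv[OF assms(1) c(1)] chart_subset[OF assms(1) c(1)] assms(4) by auto
  qed
qed

text \<open>The image of a chart domain under \<open>f\<close> need not fit into one chart of
  \<open>Y\<close>. Near each point a chart of \<open>Y\<close> around \<open>f x\<close> is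
  inserted, and the expression becomes a composite of two smooth maps of model spaces.\<close>

lemma smooth_map_compose:
  assumes "smooth_manifold X" "smooth_manifold Y" "smooth_manifold Z"
    and f: "smooth_map X Y f" and g: "smooth_map Y Z g"
  shows "smooth_map X Z (\<lambda>x. g (f x))"
proof (rule smooth_mapI)
  note cf = smooth_map_continuous[OF f] and cg = smooth_map_continuous[OF g]
  show "continuous_map (top_of X) (top_of Z) (\<lambda>x. g (f x))"
    using continuous_map_compose[OF cf cg] by (simp add: comp_def)
  fix V \<psi> V' \<psi>' assume c: "(V, \<psi>) \<in> charts X" "(V', \<psi>') \<in> charts Z"
  note oV = chart_openin[OF assms(1) c(1)]
  show "smooth_on (\<psi> ` (V \<inter> (\<lambda>x. g (f x)) -` V')) (\<psi>' \<circ> (\<lambda>x. g (f x)) \<circ> inv_into V \<psi>)"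
  proof (rule smooth_on_locally)
    fix y assume "y \<in> \<psi> ` (V \<inter> (\<lambda>x. g (f x)) -` V')"
    then obtain x where x: "x \<in> V" "g (f x) \<in> V'" "y = \<psi> x" by auto
    have "f x \<in> pts Y" using x(1) chart_subset[OF assms(1) c(1)] smooth_map_pts[OF f] by blast
    then obtain P \<rho> where P: "(P, \<rho>) \<in> charts Y" "f x \<in> P" using chart_at[OF assms(2)] by blast
    note oP = chart_openin[OF assms(2) P(1)]
    let ?Q = "P \<inter> g -` V'"
    let ?N = "V \<inter> f -` ?Q"
    have oQ: "openin (top_of Y) ?Q" by (rule openin_Int_vimage[OF cg oP chart_openin[OF assms(3) c(2)]])
    have oN: "openin (top_of X) ?N" by (rule openin_Int_vimage[OF cf oV oQ])
    have opN: "open (\<psi> ` ?N)" by (rule chart_image_open[OF assms(1) c(1) oN]) simp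
    have opQ: "open (\<rho> ` ?Q)" by (rule chart_image_open[OF assms(2) P(1) oQ]) simp
    have 1: "smooth_on (\<psi> ` ?N) (\<rho> \<circ> f \<circ> inv_into V \<psi>)"
      by (rule smooth_on_subset[OF smooth_map_in_charts[OF f c(1) P(1)]]) auto
    have 2: "smooth_on (\<rho> ` ?Q) (\<psi>' \<circ> g \<circ> inv_into P \<rho>)"
      by (rule smooth_map_in_charts[OF g P(1) c(2)])
    have 3: "(\<rho> \<circ> f \<circ> inv_into V \<psi>) ` \<psi> ` ?N \<subseteq> \<rho> ` ?Q"
      using chart_inv[OF assms(1) c(1)] by auto
    have "smooth_on (\<psi> ` ?N) (\<psi>' \<circ> (\<lambda>x. g (f x)) \<circ> inv_into V \<psi>)"
      by (rule smooth_on_image_cong[OF opN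
            smooth_on_compose[OF smooth_manifold_finite_dimensional[OF assms(2)] opN opQ 3 1 2]])
        (simp add: chart_inv[OF assms(1) c(1)] chart_inv[OF assms(2) P(1)])
    then show "\<exists>N. open N \<and> y \<in> N \<and> smooth_on N (\<psi>' \<circ> (\<lambda>x. g (f x)) \<circ> inv_into V \<psi>)"
      using opN x P(2) by blast
  qed
qed

section \<open>Open submanifolds and products\<close>

lemma top_of_open_submfd [simp]: "top_of (open_submfd X U) = subtopology (top_of X) U"
  by (simp add: open_submfd_def)

lemma chart_open_submfdE:
  assumes "(V, \<psi>) \<in> charts (open_submfd X U)"
  obtains V\<^sub>0 where "(V\<^sub>0, \<psi>) \<in> charts X" "V = V\<^sub>0 \<inter> U"
  using assms by (auto simp: open_submfd_def)

lemma chart_open_submfdI: "(V, \<psi>) \<in> charts X \<Longrightarrow> (V \<inter> U, \<psi>) \<in> charts (open_submfd X U)"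
  by (force simp: open_submfd_def)

text \<open>The coordinate expressions of the identity are precisely the transition functions of the
  atlas.\<close>

lemma smooth_map_id: "smooth_manifold X \<Longrightarrow> smooth_map X X (\<lambda>x. x)"
proof (rule smooth_mapI)
  fix V V' and \<psi> \<psi>' :: "'a \<Rightarrow> 'b"
  assume "smooth_manifold X" "(V, \<psi>) \<in> charts X" "(V', \<psi>') \<in> charts X"
  then show "smooth_on (\<psi> ` (V \<inter> (\<lambda>x. x) -` V')) (\<psi>' \<circ> (\<lambda>x. x) \<circ> inv_into V \<psi>)"
    using smooth_manifold_transition by (fastforce simp: comp_def)
qed simp

text \<open>Shrinking the chart domain from \<open>V\<^sub>0\<close> to \<open>V\<close> changes the
  inverse chart as a term, but not its values on the image of \<open>V\<close>.\<close>

lemma smooth_map_restrict_domain: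
  assumes "smooth_manifold X" "smooth_manifold Y" "smooth_map X Y f" "openin (top_of X) U"
  shows "smooth_map (open_submfd X U) Y f"
proof (rule smooth_mapI)
  note cf = smooth_map_continuous[OF assms(3)]
  show "continuous_map (top_of (open_submfd X U)) (top_of Y) f"
    using continuous_map_from_subtopology[OF cf] by simp
  fix V \<psi> V' \<psi>' assume c: "(V, \<psi>) \<in> charts (open_submfd X U)" "(V', \<psi>') \<in> charts Y"
  obtain V\<^sub>0 where V: "(V\<^sub>0, \<psi>) \<in> charts X" "V = V\<^sub>0 \<inter> U" using chart_open_submfdE[OF c(1)] .
  have oV: "openin (top_of X) V" unfolding V(2) using chart_openin[OF assms(1) V(1)] assms(4) by blast
  have inj: "inj_on \<psi> V" using chart_inj[OF assms(1) V(1)] V(2) by (auto intro: inj_on_subset)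
  have "open (\<psi> ` (V \<inter> f -` V'))"
    using chart_image_open[OF assms(1) V(1) openin_Int_vimage[OF cf oV chart_openin[OF assms(2) c(2)]]]
      V(2) by blast
  moreover have "smooth_on (\<psi> ` (V \<inter> f -` V')) (\<psi>' \<circ> f \<circ> inv_into V\<^sub>0 \<psi>)"
    by (rule smooth_on_subset[OF smooth_map_in_charts[OF assms(3) V(1) c(2)]]) (use V(2) in auto)
  ultimately show "smooth_on (\<psi> ` (V \<inter> f -` V')) (\<psi>' \<circ> f \<circ> inv_into V \<psi>)"
    by (rule smooth_on_image_cong)
      (use V(2) inv_into_f_f[OF inj] chart_inv[OF assms(1) V(1)] in auto)
qed

lemma smooth_map_into_open_submfd:
  assumes "smooth_map X Y f" "\<And>x. x \<in> pts X \<Longrightarrow> f x \<in> U"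
  shows "smooth_map X (open_submfd Y U) f"
proof (rule smooth_mapI)
  show "continuous_map (top_of X) (top_of (open_submfd Y U)) f"
    using smooth_map_continuous[OF assms(1)] assms(2) by (simp add: continuous_map_in_subtopology Pi_def)
  fix V \<psi> V' \<psi>' assume c: "(V, \<psi>) \<in> charts X" "(V', \<psi>') \<in> charts (open_submfd Y U)"
  obtain V\<^sub>0 where V: "(V\<^sub>0, \<psi>') \<in> charts Y" "V' = V\<^sub>0 \<inter> U" using chart_open_submfdE[OF c(2)] .
  show "smooth_on (\<psi> ` (V \<inter> f -` V')) (\<psi>' \<circ> f \<circ> inv_into V \<psi>)"
    by (rule smooth_on_subset[OF smooth_map_in_charts[OF assms(1) c(1) V(1)]]) (use V(2) in auto)
qed

lemma smooth_manifold_open_submfd: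
  assumes "smooth_manifold X" "openin (top_of X) U"
  shows "smooth_manifold (open_submfd X U)"
proof (rule smooth_manifoldI)
  show "Hausdorff_space (top_of (open_submfd X U))"
    using smooth_manifold_Hausdorff[OF assms(1)] by (simp add: Hausdorff_space_subtopology)
  show "second_countable (top_of (open_submfd X U))"
    using smooth_manifold_second_countable[OF assms(1)] by (simp add: second_countable_subtopology)
  show "is_chart (top_of (open_submfd X U)) V \<psi>" if c: "(V, \<psi>) \<in> charts (open_submfd X U)" for V \<psi>
  proof -
    obtain V\<^sub>0 where V: "(V\<^sub>0, \<psi>) \<in> charts X" "V = V\<^sub>0 \<inter> U" using chart_open_submfdE[OF c] .
    show ?thesis using is_chart_Int_open[OF smooth_manifold_chart[OF assms(1) V(1)] assms(2)] V(2) by simp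
  qed
  have "(\<Union>(V, \<psi>)\<in>charts (open_submfd X U). V) = (\<Union>(V, \<psi>)\<in>charts X. V) \<inter> U"
    by (auto simp: open_submfd_def)
  then show "(\<Union>(V, \<psi>)\<in>charts (open_submfd X U). V) = pts (open_submfd X U)"
    by (simp add: smooth_manifold_cover[OF assms(1)])
  fix V \<psi> V' \<psi>' assume c: "(V, \<psi>) \<in> charts (open_submfd X U)" "(V', \<psi>') \<in> charts (open_submfd X U)"
  \<comment> \<open>Conversely to \<open>smooth_map_id\<close>, compatibility of the restricted
    charts is read off from smoothness of the identity of the open submanifold.\<close>
  have i: "smooth_map (open_submfd X U) X (\<lambda>x. x)"
    by (rule smooth_map_restrict_domain[OF assms(1,1) smooth_map_id[OF assms(1)] assms(2)])
  have "smooth_map (open_submfd X U) (open_submfd X U) (\<lambda>x. x)"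
    by (rule smooth_map_into_open_submfd[OF i]) simp
  then show "smooth_on (\<psi> ` (V \<inter> V')) (\<psi>' \<circ> inv_into V \<psi>)"
    using smooth_map_in_charts[OF _ c] by (fastforce simp: comp_def)
qed (rule smooth_manifold_finite_dimensional[OF assms(1)])

lemma smooth_map_open_submfd_inclusion:
  assumes "smooth_manifold X" "openin (top_of X) U"
  shows "smooth_map (open_submfd X U) X (\<lambda>x. x)"
  by (rule smooth_map_restrict_domain[OF assms(1,1) smooth_map_id[OF assms(1)] assms(2)])

lemma smooth_map_locally:
  assumes "smooth_manifold X" "smooth_manifold Y"
    and loc: "\<And>x. x \<in> pts X \<Longrightarrow>
      \<exists>N. openin (top_of X) N \<and> x \<in> N \<and> smooth_map (open_submfd X N) Y f"
  shows "smooth_map X Y f"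
proof (rule smooth_mapI)
  show "continuous_map (top_of X) (top_of Y) f"
    unfolding continuous_map
  proof (intro conjI allI impI)
    show "f ` pts X \<subseteq> pts Y"
    proof clarify
      fix x assume x: "x \<in> pts X"
      obtain N where "openin (top_of X) N" "x \<in> N" "smooth_map (open_submfd X N) Y f"
        using loc[OF x] by blast
      then show "f x \<in> pts Y" using smooth_map_pts[of "open_submfd X N" Y f x] x by simp
    qed
    fix P assume P: "openin (top_of Y) P"
    show "openin (top_of X) {x \<in> pts X. f x \<in> P}"
    proof (subst openin_subopen, intro ballI)
      fix x assume x: "x \<in> {x \<in> pts X. f x \<in> P}"
      then obtain N where N: "openin (top_of X) N" "x \<in> N" "smooth_map (open_submfd X N) Y f"
        using loc[of x] by blast
      have "openin (subtopology (top_of X) N) {x \<in> topspace (subtopology (top_of X) N). f x \<in> P}"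
        using openin_continuous_map_preimage[OF smooth_map_continuous[OF N(3)] P] by simp
      then have "openin (top_of X) {x \<in> pts X \<inter> N. f x \<in> P}"
        using N(1) by (simp add: openin_open_subtopology)
      then show "\<exists>T. openin (top_of X) T \<and> x \<in> T \<and> T \<subseteq> {x \<in> pts X. f x \<in> P}"
        using x N(2) by (intro exI[of _ "{x \<in> pts X \<inter> N. f x \<in> P}"]) auto
    qed
  qed
  fix V \<psi> V' \<psi>' assume c: "(V, \<psi>) \<in> charts X" "(V', \<psi>') \<in> charts Y"
  show "smooth_on (\<psi> ` (V \<inter> f -` V')) (\<psi>' \<circ> f \<circ> inv_into V \<psi>)"
  proof (rule smooth_on_locally)
    fix y assume "y \<in> \<psi> ` (V \<inter> f -` V')"
    then obtain x where x: "x \<in> V" "f x \<in> V'" "y = \<psi> x" by auto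
    have "x \<in> pts X" using x(1) chart_subset[OF assms(1) c(1)] by blast
    then obtain N where N: "openin (top_of X) N" "x \<in> N" "smooth_map (open_submfd X N) Y f"
      using loc[of x] by blast
    note cN = chart_open_submfdI[OF c(1), of N]
    note mN = smooth_manifold_open_submfd[OF assms(1) N(1)]
    let ?N = "V \<inter> N \<inter> f -` V'"
    have "openin (top_of (open_submfd X N)) ?N"
      by (rule openin_Int_vimage[OF smooth_map_continuous[OF N(3)] chart_openin[OF mN cN]
            chart_openin[OF assms(2) c(2)]])
    from chart_image_open[OF mN cN this Int_lower1] have op: "open (\<psi> ` ?N)" .
    have "smooth_on (\<psi> ` ?N) (\<psi>' \<circ> f \<circ> inv_into V \<psi>)"
      by (rule smooth_on_image_cong[OF op smooth_map_in_charts[OF N(3) cN c(2)]])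
        (simp add: chart_inv[OF assms(1) c(1)] chart_inv[OF mN cN])
    moreover have "y \<in> \<psi> ` ?N" using x N(2) by simp
    ultimately show "\<exists>N. open N \<and> y \<in> N \<and> smooth_on N (\<psi>' \<circ> f \<circ> inv_into V \<psi>)"
      using op by (intro exI conjI)
  qed
qed

section \<open>Products of manifolds\<close>

lemma top_of_prod_mfd [simp]: "top_of (X \<times>\<^sub>M Y) = prod_topology (top_of X) (top_of Y)"
  by (simp add: prod_mfd_def)

lemma chart_prod_mfdE:
  assumes "(V, \<psi>) \<in> charts (X \<times>\<^sub>M Y)"
  obtains V\<^sub>1 \<psi>\<^sub>1 V\<^sub>2 \<psi>\<^sub>2 where "(V\<^sub>1, \<psi>\<^sub>1) \<in> charts X" "(V\<^sub>2, \<psi>\<^sub>2) \<in> charts Y"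
    "V = V\<^sub>1 \<times> V\<^sub>2" "\<psi> = map_prod \<psi>\<^sub>1 \<psi>\<^sub>2"
  using assms by (auto simp: prod_mfd_def)

lemma smooth_map_Pair:
  assumes "smooth_manifold Z" "smooth_manifold X" "smooth_manifold Y"
    and f: "smooth_map Z X f" and g: "smooth_map Z Y g"
  shows "smooth_map Z (X \<times>\<^sub>M Y) (\<lambda>z. (f z, g z))"
proof (rule smooth_mapI)
  note cf = smooth_map_continuous[OF f] and cg = smooth_map_continuous[OF g]
  show "continuous_map (top_of Z) (top_of (X \<times>\<^sub>M Y)) (\<lambda>z. (f z, g z))"
    using continuous_map_pairedI[OF cf cg] by simp
  fix V \<psi> V' \<psi>' assume c: "(V, \<psi>) \<in> charts Z" "(V', \<psi>') \<in> charts (X \<times>\<^sub>M Y)"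
  obtain V\<^sub>1 \<psi>\<^sub>1 V\<^sub>2 \<psi>\<^sub>2 where d: "(V\<^sub>1, \<psi>\<^sub>1) \<in> charts X" "(V\<^sub>2, \<psi>\<^sub>2) \<in> charts Y"
    "V' = V\<^sub>1 \<times> V\<^sub>2" "\<psi>' = map_prod \<psi>\<^sub>1 \<psi>\<^sub>2" using chart_prod_mfdE[OF c(2)] .
  let ?N = "V \<inter> f -` V\<^sub>1 \<inter> g -` V\<^sub>2"
  have "openin (top_of Z) ?N"
    by (intro openin_Int_vimage[OF cg] openin_Int_vimage[OF cf] chart_openin[OF assms(1) c(1)]
        chart_openin[OF assms(2) d(1)] chart_openin[OF assms(3) d(2)])
  from chart_image_open[OF assms(1) c(1) this] have op: "open (\<psi> ` ?N)" by blast
  have "smooth_on (\<psi> ` ?N) (\<lambda>z. ((\<psi>\<^sub>1 \<circ> f \<circ> inv_into V \<psi>) z, (\<psi>\<^sub>2 \<circ> g \<circ> inv_into V \<psi>) z))"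
    by (rule smooth_on_Pair[OF op smooth_on_subset[OF smooth_map_in_charts[OF f c(1) d(1)]]
          smooth_on_subset[OF smooth_map_in_charts[OF g c(1) d(2)]]]) auto
  moreover have "V \<inter> (\<lambda>z. (f z, g z)) -` V' = ?N" using d(3) by auto
  ultimately show "smooth_on (\<psi> ` (V \<inter> (\<lambda>z. (f z, g z)) -` V'))
      (\<psi>' \<circ> (\<lambda>z. (f z, g z)) \<circ> inv_into V \<psi>)"
    by (simp add: d(4) comp_def)
qed

lemma chart_prod_mfd_rep:
  assumes "smooth_manifold X" "smooth_manifold Y" "(V, \<psi>) \<in> charts X" "(V', \<psi>') \<in> charts Y"
    "x \<in> V" "y \<in> V'"
  shows "inv_into (V \<times> V') (map_prod \<psi> \<psi>') (\<psi> x, \<psi>' y) = (x, y)"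
proof -
  have "inj_on (map_prod \<psi> \<psi>') (V \<times> V')"
    by (rule map_prod_inj_on[OF chart_inj[OF assms(1,3)] chart_inj[OF assms(2,4)]])
  from inv_into_f_f[OF this, of "(x, y)"] show ?thesis using assms(5,6) by simp
qed

lemma chart_prod_mfd_open:
  assumes "smooth_manifold X" "smooth_manifold Y" "(V, \<psi>) \<in> charts X" "(V', \<psi>') \<in> charts Y"
    "openin (top_of X) N" "N \<subseteq> V" "openin (top_of Y) N'" "N' \<subseteq> V'"
  shows "open (map_prod \<psi> \<psi>' ` (N \<times> N'))"
  using chart_image_open[OF assms(1,3,5,6)] chart_image_open[OF assms(2,4,7,8)]
  by (simp add: map_prod_surj_on open_Times)

text \<open>The new function is a composite with a linear projection. In this way \<open>fst\<close>
  and \<open>snd\<close>, whose coordinate expressions are transition functions of one factor after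
  projection, turn out smooth, as do transitions of the product atlas.\<close>

lemma smooth_on_prod_chart:
  assumes "smooth_manifold X" "smooth_manifold Y" "(V, \<psi>) \<in> charts X" "(V', \<psi>') \<in> charts Y"
    "openin (top_of X) N" "N \<subseteq> V" "openin (top_of Y) N'" "N' \<subseteq> V'"
  shows "smooth_on (\<psi> ` N) F \<Longrightarrow> smooth_on (map_prod \<psi> \<psi>' ` (N \<times> N')) (\<lambda>z. F (fst z))"
    and "smooth_on (\<psi>' ` N') G \<Longrightarrow> smooth_on (map_prod \<psi> \<psi>' ` (N \<times> N')) (\<lambda>z. G (snd z))"
proof -
  note op = chart_prod_mfd_open[OF assms]
  show "smooth_on (map_prod \<psi> \<psi>' ` (N \<times> N')) (\<lambda>z. F (fst z))" if "smooth_on (\<psi> ` N) F"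
    by (rule smooth_on_compose[OF smooth_manifold_finite_dimensional[OF assms(1)] op
          chart_image_open[OF assms(1,3,5,6)] _ smooth_on_bounded_linear[OF op bounded_linear_fst] that])
      auto
  show "smooth_on (map_prod \<psi> \<psi>' ` (N \<times> N')) (\<lambda>z. G (snd z))" if "smooth_on (\<psi>' ` N') G"
    by (rule smooth_on_compose[OF smooth_manifold_finite_dimensional[OF assms(2)] op
          chart_image_open[OF assms(2,4,7,8)] _ smooth_on_bounded_linear[OF op bounded_linear_snd] that])
      auto
qed

lemma smooth_map_fst:
  assumes X: "smooth_manifold X" and Y: "smooth_manifold Y"
  shows "smooth_map (X \<times>\<^sub>M Y) X fst"
proof (rule smooth_mapI)
  show "continuous_map (top_of (X \<times>\<^sub>M Y)) (top_of X) fst" by (simp add: continuous_map_fst)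
  fix V \<psi> P \<rho> assume c: "(V, \<psi>) \<in> charts (X \<times>\<^sub>M Y)" "(P, \<rho>) \<in> charts X"
  obtain V\<^sub>1 \<psi>\<^sub>1 V\<^sub>2 \<psi>\<^sub>2 where d: "(V\<^sub>1, \<psi>\<^sub>1) \<in> charts X" "(V\<^sub>2, \<psi>\<^sub>2) \<in> charts Y"
    "V = V\<^sub>1 \<times> V\<^sub>2" "\<psi> = map_prod \<psi>\<^sub>1 \<psi>\<^sub>2" using chart_prod_mfdE[OF c(1)] .
  note o = openin_Int[OF chart_openin[OF X d(1)] chart_openin[OF X c(2)]] chart_openin[OF Y d(2)]
  note op = chart_prod_mfd_open[OF X Y d(1,2) o(1) Int_lower1 o(2) subset_refl]
  have "V \<inter> fst -` P = (V\<^sub>1 \<inter> P) \<times> V\<^sub>2" using d(3) by auto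
  moreover have "smooth_on (map_prod \<psi>\<^sub>1 \<psi>\<^sub>2 ` ((V\<^sub>1 \<inter> P) \<times> V\<^sub>2)) (\<rho> \<circ> fst \<circ> inv_into V \<psi>)"
    by (rule smooth_on_image_cong[OF op smooth_on_prod_chart(1)[OF X Y d(1,2) o(1) Int_lower1 o(2)
            subset_refl smooth_manifold_transition[OF X d(1) c(2)]]])
      (auto simp: d chart_prod_mfd_rep[OF X Y d(1,2)] chart_inv[OF X d(1)])
  ultimately show "smooth_on (\<psi> ` (V \<inter> fst -` P)) (\<rho> \<circ> fst \<circ> inv_into V \<psi>)"
    by (simp add: d(4))
qed

lemma smooth_map_snd:
  assumes X: "smooth_manifold X" and Y: "smooth_manifold Y"
  shows "smooth_map (X \<times>\<^sub>M Y) Y snd"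
proof (rule smooth_mapI)
  show "continuous_map (top_of (X \<times>\<^sub>M Y)) (top_of Y) snd" by (simp add: continuous_map_snd)
  fix V \<psi> P \<rho> assume c: "(V, \<psi>) \<in> charts (X \<times>\<^sub>M Y)" "(P, \<rho>) \<in> charts Y"
  obtain V\<^sub>1 \<psi>\<^sub>1 V\<^sub>2 \<psi>\<^sub>2 where d: "(V\<^sub>1, \<psi>\<^sub>1) \<in> charts X" "(V\<^sub>2, \<psi>\<^sub>2) \<in> charts Y"
    "V = V\<^sub>1 \<times> V\<^sub>2" "\<psi> = map_prod \<psi>\<^sub>1 \<psi>\<^sub>2" using chart_prod_mfdE[OF c(1)] .
  note o = chart_openin[OF X d(1)] openin_Int[OF chart_openin[OF Y d(2)] chart_openin[OF Y c(2)]]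
  note op = chart_prod_mfd_open[OF X Y d(1,2) o(1) subset_refl o(2) Int_lower1]
  have "V \<inter> snd -` P = V\<^sub>1 \<times> (V\<^sub>2 \<inter> P)" using d(3) by auto
  moreover have "smooth_on (map_prod \<psi>\<^sub>1 \<psi>\<^sub>2 ` (V\<^sub>1 \<times> (V\<^sub>2 \<inter> P))) (\<rho> \<circ> snd \<circ> inv_into V \<psi>)"
    by (rule smooth_on_image_cong[OF op smooth_on_prod_chart(2)[OF X Y d(1,2) o(1) subset_refl o(2)
            Int_lower1 smooth_manifold_transition[OF Y d(2) c(2)]]])
      (auto simp: d chart_prod_mfd_rep[OF X Y d(1,2)] chart_inv[OF Y d(2)])
  ultimately show "smooth_on (\<psi> ` (V \<inter> snd -` P)) (\<rho> \<circ> snd \<circ> inv_into V \<psi>)"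
    by (simp add: d(4))
qed

lemma smooth_manifold_prod_mfd:
  assumes X: "smooth_manifold (X :: ('a, 'd::real_normed_vector) mfd)"
    and Y: "smooth_manifold (Y :: ('b, 'e::real_normed_vector) mfd)"
  shows "smooth_manifold (X \<times>\<^sub>M Y)"
proof (rule smooth_manifoldI)
  show "finite_dimensional TYPE('d \<times> 'e)"
    by (rule finite_dimensional_prod[OF smooth_manifold_finite_dimensional[OF X]
          smooth_manifold_finite_dimensional[OF Y]])
  show "Hausdorff_space (top_of (X \<times>\<^sub>M Y))"
    using smooth_manifold_Hausdorff[OF X] smooth_manifold_Hausdorff[OF Y]
    by (simp add: Hausdorff_space_prod_topology)
  show "second_countable (top_of (X \<times>\<^sub>M Y))"
    using second_countable_prod_topology[OF smooth_manifold_second_countable[OF X]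
        smooth_manifold_second_countable[OF Y]] by simp
  show "is_chart (top_of (X \<times>\<^sub>M Y)) V \<psi>" if c: "(V, \<psi>) \<in> charts (X \<times>\<^sub>M Y)" for V \<psi>
  proof -
    obtain V\<^sub>1 \<psi>\<^sub>1 V\<^sub>2 \<psi>\<^sub>2 where d: "(V\<^sub>1, \<psi>\<^sub>1) \<in> charts X" "(V\<^sub>2, \<psi>\<^sub>2) \<in> charts Y"
      "V = V\<^sub>1 \<times> V\<^sub>2" "\<psi> = map_prod \<psi>\<^sub>1 \<psi>\<^sub>2" using chart_prod_mfdE[OF c] .
    show ?thesis
      using is_chart_prod[OF smooth_manifold_chart[OF X d(1)] smooth_manifold_chart[OF Y d(2)]] d(3,4)
      by simp
  qed
  have "(\<Union>(V, \<psi>)\<in>charts (X \<times>\<^sub>M Y). V) = (\<Union>(V, \<psi>)\<in>charts X. V) \<times> (\<Union>(V, \<psi>)\<in>charts Y. V)"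
    by (force simp: prod_mfd_def)
  then show "(\<Union>(V, \<psi>)\<in>charts (X \<times>\<^sub>M Y). V) = pts (X \<times>\<^sub>M Y)"
    by (simp add: smooth_manifold_cover[OF X] smooth_manifold_cover[OF Y])
  fix V \<psi> P \<rho> assume c: "(V, \<psi>) \<in> charts (X \<times>\<^sub>M Y)" "(P, \<rho>) \<in> charts (X \<times>\<^sub>M Y)"
  obtain V\<^sub>1 \<psi>\<^sub>1 V\<^sub>2 \<psi>\<^sub>2 where d: "(V\<^sub>1, \<psi>\<^sub>1) \<in> charts X" "(V\<^sub>2, \<psi>\<^sub>2) \<in> charts Y"
    "V = V\<^sub>1 \<times> V\<^sub>2" "\<psi> = map_prod \<psi>\<^sub>1 \<psi>\<^sub>2" using chart_prod_mfdE[OF c(1)] .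
  obtain P\<^sub>1 \<rho>\<^sub>1 P\<^sub>2 \<rho>\<^sub>2 where e: "(P\<^sub>1, \<rho>\<^sub>1) \<in> charts X" "(P\<^sub>2, \<rho>\<^sub>2) \<in> charts Y"
    "P = P\<^sub>1 \<times> P\<^sub>2" "\<rho> = map_prod \<rho>\<^sub>1 \<rho>\<^sub>2" using chart_prod_mfdE[OF c(2)] .
  note o = openin_Int[OF chart_openin[OF X d(1)] chart_openin[OF X e(1)]]
    openin_Int[OF chart_openin[OF Y d(2)] chart_openin[OF Y e(2)]]
  note op = chart_prod_mfd_open[OF X Y d(1,2) o(1) Int_lower1 o(2) Int_lower1]
  note s = smooth_on_prod_chart[OF X Y d(1,2) o(1) Int_lower1 o(2) Int_lower1]
  have "V \<inter> P = (V\<^sub>1 \<inter> P\<^sub>1) \<times> (V\<^sub>2 \<inter> P\<^sub>2)" using d(3) e(3) by auto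
  moreover have "smooth_on (map_prod \<psi>\<^sub>1 \<psi>\<^sub>2 ` ((V\<^sub>1 \<inter> P\<^sub>1) \<times> (V\<^sub>2 \<inter> P\<^sub>2))) (\<rho> \<circ> inv_into V \<psi>)"
    by (rule smooth_on_image_cong[OF op smooth_on_Pair[OF op
            s(1)[OF smooth_manifold_transition[OF X d(1) e(1)]]
            s(2)[OF smooth_manifold_transition[OF Y d(2) e(2)]]]])
      (auto simp: d e chart_prod_mfd_rep[OF X Y d(1,2)] chart_inv[OF X d(1)] chart_inv[OF Y d(2)])
  ultimately show "smooth_on (\<psi> ` (V \<inter> P)) (\<rho> \<circ> inv_into V \<psi>)"
    by (simp add: d(4))
qed

section \<open>Gluing manifolds along open overlaps\<close>

text \<open>The underlying set is the union of the \<open>N \<alpha>\<close> inside one type, so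
  points need not be identified here; only topology and atlas are transported from the pieces.
  Transitions are assumed for every ordered pair of indices, which makes each of them a
  diffeomorphism between overlaps.\<close>

locale manifold_gluing =
  fixes A :: "'i set" and N :: "'i \<Rightarrow> 'm set"
    and X :: "'i \<Rightarrow> ('x, 'e::real_normed_vector) mfd" and \<phi> :: "'i \<Rightarrow> 'm \<Rightarrow> 'x"
  assumes piece: "\<alpha> \<in> A \<Longrightarrow> smooth_manifold (X \<alpha>)"
    and bij: "\<alpha> \<in> A \<Longrightarrow> bij_betw (\<phi> \<alpha>) (N \<alpha>) (pts (X \<alpha>))"
    and overlap_open: "\<alpha> \<in> A \<Longrightarrow> \<beta> \<in> A \<Longrightarrow> openin (top_of (X \<alpha>)) (\<phi> \<alpha> ` (N \<alpha> \<inter> N \<beta>))"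
    and transition: "\<alpha> \<in> A \<Longrightarrow> \<beta> \<in> A \<Longrightarrow>
      smooth_map (open_submfd (X \<alpha>) (\<phi> \<alpha> ` (N \<alpha> \<inter> N \<beta>))) (X \<beta>)
        (\<lambda>x. \<phi> \<beta> (inv_into (N \<alpha>) (\<phi> \<alpha>) x))"
begin

section \<open>Topology of the glued space\<close>

text \<open>The finest topology on the union for which all inverse charts from the pieces are
  continuous. The inclusion clause confines the space to the union of the
  \<open>N \<alpha>\<close>.\<close>

definition glued_open :: "'m set \<Rightarrow> bool" where
  "glued_open W \<longleftrightarrow> W \<subseteq> \<Union>(N ` A) \<and> (\<forall>\<alpha>\<in>A. openin (top_of (X \<alpha>)) (\<phi> \<alpha> ` (W \<inter> N \<alpha>)))"

definition glued :: "('m, 'e) mfd" where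
  "glued = \<lparr>top_of = topology glued_open,
    charts = (\<Union>\<alpha>\<in>A. (\<lambda>(V, \<psi>). (N \<alpha> \<inter> \<phi> \<alpha> -` V, \<psi> \<circ> \<phi> \<alpha>)) ` charts (X \<alpha>))\<rparr>"

lemma inj: "\<alpha> \<in> A \<Longrightarrow> inj_on (\<phi> \<alpha>) (N \<alpha>)"
  using bij by (simp add: bij_betw_def)

lemma image_N: "\<alpha> \<in> A \<Longrightarrow> \<phi> \<alpha> ` N \<alpha> = pts (X \<alpha>)"
  using bij by (simp add: bij_betw_def)

lemma inv_\<phi>: "\<alpha> \<in> A \<Longrightarrow> m \<in> N \<alpha> \<Longrightarrow> inv_into (N \<alpha>) (\<phi> \<alpha>) (\<phi> \<alpha> m) = m"
  using inj by (simp add: inv_into_f_f)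

lemma inv_\<phi>_in: "\<alpha> \<in> A \<Longrightarrow> x \<in> pts (X \<alpha>) \<Longrightarrow> inv_into (N \<alpha>) (\<phi> \<alpha>) x \<in> N \<alpha>"
  using image_N inv_into_into by metis

lemma \<phi>_inv: "\<alpha> \<in> A \<Longrightarrow> x \<in> pts (X \<alpha>) \<Longrightarrow> \<phi> \<alpha> (inv_into (N \<alpha>) (\<phi> \<alpha>) x) = x"
  using image_N f_inv_into_f by metis

lemma istopology_glued_open: "istopology glued_open"
  unfolding istopology_def
proof (intro conjI allI impI)
  fix S T assume S: "glued_open S" and T: "glued_open T"
  have "openin (top_of (X \<alpha>)) (\<phi> \<alpha> ` (S \<inter> T \<inter> N \<alpha>))" if a: "\<alpha> \<in> A" for \<alpha>
  proof -
    \<comment> \<open>Images commute with intersections here because \<open>\<phi> \<alpha>\<close>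
      is injective on \<open>N \<alpha>\<close>.\<close>
    have "\<phi> \<alpha> ` ((S \<inter> N \<alpha>) \<inter> (T \<inter> N \<alpha>)) = \<phi> \<alpha> ` (S \<inter> N \<alpha>) \<inter> \<phi> \<alpha> ` (T \<inter> N \<alpha>)"
      by (rule inj_on_image_Int[OF inj[OF a]]) auto
    moreover have "(S \<inter> N \<alpha>) \<inter> (T \<inter> N \<alpha>) = S \<inter> T \<inter> N \<alpha>" by auto
    ultimately show ?thesis using S T a openin_Int unfolding glued_open_def by metis
  qed
  then show "glued_open (S \<inter> T)" using S unfolding glued_open_def by auto
next
  fix \<K> assume K: "\<forall>K\<in>\<K>. glued_open K"
  have "openin (top_of (X \<alpha>)) (\<phi> \<alpha> ` (\<Union>\<K> \<inter> N \<alpha>))" if a: "\<alpha> \<in> A" for \<alpha>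
  proof -
    have "\<phi> \<alpha> ` (\<Union>\<K> \<inter> N \<alpha>) = \<Union>((\<lambda>K. \<phi> \<alpha> ` (K \<inter> N \<alpha>)) ` \<K>)" by auto
    moreover have "openin (top_of (X \<alpha>)) \<dots>"
      using K a by (intro openin_Union) (auto simp: glued_open_def)
    ultimately show ?thesis by simp
  qed
  then show "glued_open (\<Union>\<K>)" using K unfolding glued_open_def by auto
qed

lemma openin_glued: "openin (top_of glued) W \<longleftrightarrow> glued_open W"
  using istopology_glued_open by (simp add: glued_def)

text \<open>This is where openness of the overlaps enters: seen from each piece,
  \<open>N \<alpha>\<close> is an overlap.\<close>

lemma openin_N: "\<alpha> \<in> A \<Longrightarrow> openin (top_of glued) (N \<alpha>)"
  using overlap_open[of _ \<alpha>] by (auto simp: openin_glued glued_open_def Int_commute)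

lemma pts_glued: "pts glued = \<Union>(N ` A)"
proof
  show "pts glued \<subseteq> \<Union>(N ` A)"
    using openin_topspace[of "top_of glued"] unfolding openin_glued glued_open_def by blast
  show "\<Union>(N ` A) \<subseteq> pts glued" using openin_N openin_subset by fastforce
qed

text \<open>A set inside one piece can be tested in that piece alone, because continuity of the
  transition maps carries openness to all the others.\<close>

lemma openin_glued_piece:
  assumes "\<alpha> \<in> A" "W \<subseteq> N \<alpha>"
  shows "openin (top_of glued) W \<longleftrightarrow> openin (top_of (X \<alpha>)) (\<phi> \<alpha> ` W)"
proof
  assume "openin (top_of glued) W"
  then have "openin (top_of (X \<alpha>)) (\<phi> \<alpha> ` (W \<inter> N \<alpha>))"
    using assms(1) unfolding openin_glued glued_open_def by blast
  then show "openin (top_of (X \<alpha>)) (\<phi> \<alpha> ` W)" using assms(2) by (simp add: Int_absorb2)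
next
  assume W: "openin (top_of (X \<alpha>)) (\<phi> \<alpha> ` W)"
  have "openin (top_of (X \<beta>)) (\<phi> \<beta> ` (W \<inter> N \<beta>))" if b: "\<beta> \<in> A" for \<beta>
  proof -
    let ?Q = "\<phi> \<beta> ` (N \<beta> \<inter> N \<alpha>)"
    let ?\<tau> = "\<lambda>x. \<phi> \<alpha> (inv_into (N \<beta>) (\<phi> \<beta>) x)"
    note o = overlap_open[OF b assms(1)]
    have "openin (top_of (open_submfd (X \<beta>) ?Q)) (?Q \<inter> ?\<tau> -` (\<phi> \<alpha> ` W))"
      by (rule openin_Int_vimage[OF smooth_map_continuous[OF transition[OF b assms(1)]] _ W])
        (use o in \<open>simp add: openin_open_subtopology\<close>)
    then have "openin (top_of (X \<beta>)) (?Q \<inter> ?\<tau> -` (\<phi> \<alpha> ` W))"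
      using o by (simp add: openin_open_subtopology)
    \<comment> \<open>Seen from \<open>\<beta>\<close>, the part of \<open>W\<close> in the overlap
      is the preimage, under the transition from \<open>\<beta>\<close> to \<open>\<alpha>\<close>,
      of the copy of \<open>W\<close> in \<open>X \<alpha>\<close>.\<close>
    moreover have "?Q \<inter> ?\<tau> -` (\<phi> \<alpha> ` W) = \<phi> \<beta> ` (W \<inter> N \<beta>)"
      using assms(2) inv_\<phi>[OF b] inj_onD[OF inj[OF assms(1)]] by fastforce
    ultimately show ?thesis by simp
  qed
  then show "openin (top_of glued) W"
    using assms unfolding openin_glued glued_open_def by blast
qed

lemma openin_glued_vimage:
  assumes "\<alpha> \<in> A" "openin (top_of (X \<alpha>)) V"
  shows "openin (top_of glued) (N \<alpha> \<inter> \<phi> \<alpha> -` V)"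
proof -
  have "\<phi> \<alpha> ` (N \<alpha> \<inter> \<phi> \<alpha> -` V) = V"
    using openin_subset[OF assms(2)] unfolding image_N[OF assms(1), symmetric] by blast
  then show ?thesis using openin_glued_piece[OF assms(1), of "N \<alpha> \<inter> \<phi> \<alpha> -` V"] assms(2) by simp
qed

lemma continuous_map_\<phi>:
  assumes "\<alpha> \<in> A"
  shows "continuous_map (subtopology (top_of glued) (N \<alpha>)) (top_of (X \<alpha>)) (\<phi> \<alpha>)"
proof -
  have ts: "topspace (subtopology (top_of glued) (N \<alpha>)) = N \<alpha>"
    using openin_subset[OF openin_N[OF assms]] by auto
  have "openin (subtopology (top_of glued) (N \<alpha>)) {m \<in> N \<alpha>. \<phi> \<alpha> m \<in> V}"
    if "openin (top_of (X \<alpha>)) V" for V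
  proof -
    have "{m \<in> N \<alpha>. \<phi> \<alpha> m \<in> V} = N \<alpha> \<inter> \<phi> \<alpha> -` V" by auto
    then show ?thesis
      using openin_glued_vimage[OF assms that] openin_N[OF assms] by (simp add: openin_open_subtopology)
  qed
  then show ?thesis unfolding continuous_map ts using image_N[OF assms] by simp
qed

section \<open>The glued atlas and its countability\<close>

lemma chart_gluedE:
  assumes "(V, \<psi>) \<in> charts glued"
  obtains \<alpha> V\<^sub>0 \<psi>\<^sub>0 where "\<alpha> \<in> A" "(V\<^sub>0, \<psi>\<^sub>0) \<in> charts (X \<alpha>)"
    "V = N \<alpha> \<inter> \<phi> \<alpha> -` V\<^sub>0" "\<psi> = \<psi>\<^sub>0 \<circ> \<phi> \<alpha>"
  using assms by (auto simp: glued_def)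

lemma chart_gluedI:
  "\<alpha> \<in> A \<Longrightarrow> (V, \<psi>) \<in> charts (X \<alpha>) \<Longrightarrow> (N \<alpha> \<inter> \<phi> \<alpha> -` V, \<psi> \<circ> \<phi> \<alpha>) \<in> charts glued"
  by (force simp: glued_def)

lemma is_chart_glued:
  assumes a: "\<alpha> \<in> A" and c: "(V, \<psi>) \<in> charts (X \<alpha>)"
  shows "is_chart (top_of glued) (N \<alpha> \<inter> \<phi> \<alpha> -` V) (\<psi> \<circ> \<phi> \<alpha>)"
  unfolding is_chart_iff
proof (intro conjI allI impI)
  note m = piece[OF a]
  show "openin (top_of glued) (N \<alpha> \<inter> \<phi> \<alpha> -` V)"
    by (rule openin_glued_vimage[OF a chart_openin[OF m c]])
  show "inj_on (\<psi> \<circ> \<phi> \<alpha>) (N \<alpha> \<inter> \<phi> \<alpha> -` V)"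
    by (rule comp_inj_on[OF inj_on_subset[OF inj[OF a]] inj_on_subset[OF chart_inj[OF m c]]]) auto
  fix K assume K: "openin (top_of glued) K" "K \<subseteq> N \<alpha> \<inter> \<phi> \<alpha> -` V"
  have "openin (top_of (X \<alpha>)) (\<phi> \<alpha> ` K)" using openin_glued_piece[OF a, of K] K by simp
  moreover have "\<phi> \<alpha> ` K \<subseteq> V" using K(2) by auto
  ultimately show "open ((\<psi> \<circ> \<phi> \<alpha>) ` K)"
    unfolding image_comp[symmetric] by (rule chart_image_open[OF m c])
next
  fix G :: "'e set" assume G: "open G"
  have "N \<alpha> \<inter> \<phi> \<alpha> -` V \<inter> (\<psi> \<circ> \<phi> \<alpha>) -` G = N \<alpha> \<inter> \<phi> \<alpha> -` (V \<inter> \<psi> -` G)" by auto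
  then show "openin (top_of glued) (N \<alpha> \<inter> \<phi> \<alpha> -` V \<inter> (\<psi> \<circ> \<phi> \<alpha>) -` G)"
    using openin_glued_vimage[OF a chart_vimage_open[OF piece[OF a] c G]] by simp
qed

text \<open>The common core of three smoothness proofs: transitions of the glued atlas, the maps
  \<open>\<phi> \<alpha>\<close>, and their inverses. Prescribing \<open>F\<close> only by its
  values on \<open>K\<close> covers the different \<open>inv_into\<close> terms that occur in
  them.\<close>

lemma smooth_on_glued_overlap:
  assumes a: "\<alpha> \<in> A" "(V, \<psi>) \<in> charts (X \<alpha>)" and b: "\<beta> \<in> A" "(V', \<psi>') \<in> charts (X \<beta>)"
    and K: "K = (N \<alpha> \<inter> \<phi> \<alpha> -` V) \<inter> (N \<beta> \<inter> \<phi> \<beta> -` V')"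
    and F: "\<And>m. m \<in> K \<Longrightarrow> F (\<psi> (\<phi> \<alpha> m)) = \<psi>' (\<phi> \<beta> m)"
  shows "smooth_on ((\<psi> \<circ> \<phi> \<alpha>) ` K) F"
proof -
  let ?Q = "\<phi> \<alpha> ` (N \<alpha> \<inter> N \<beta>)"
  let ?\<tau> = "\<lambda>x. \<phi> \<beta> (inv_into (N \<alpha>) (\<phi> \<alpha>) x)"
  note cQ = chart_open_submfdI[OF a(2), of ?Q]
  note mQ = smooth_manifold_open_submfd[OF piece[OF a(1)] overlap_open[OF a(1) b(1)]]
  have "openin (top_of glued) K"
    unfolding K by (intro openin_Int openin_glued_vimage a(1) b(1)
        chart_openin[OF piece[OF a(1)] a(2)] chart_openin[OF piece[OF b(1)] b(2)])
  then have op: "open ((\<psi> \<circ> \<phi> \<alpha>) ` K)"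
    using is_chart_glued[OF a] unfolding is_chart_iff K by blast
  have sub: "(\<psi> \<circ> \<phi> \<alpha>) ` K \<subseteq> \<psi> ` (V \<inter> ?Q \<inter> ?\<tau> -` V')"
  proof
    fix y assume "y \<in> (\<psi> \<circ> \<phi> \<alpha>) ` K"
    then obtain m where m: "m \<in> N \<alpha>" "\<phi> \<alpha> m \<in> V" "m \<in> N \<beta>" "\<phi> \<beta> m \<in> V'" "y = \<psi> (\<phi> \<alpha> m)"
      unfolding K by auto
    have "\<phi> \<alpha> m \<in> V \<inter> ?Q \<inter> ?\<tau> -` V'" using m by (simp add: inv_\<phi>[OF a(1)])
    then show "y \<in> \<psi> ` (V \<inter> ?Q \<inter> ?\<tau> -` V')" unfolding m(5) by (rule imageI)
  qed
  show ?thesis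
  proof (rule smooth_on_image_cong[OF op smooth_on_subset[OF
          smooth_map_in_charts[OF transition[OF a(1) b(1)] cQ b(2)] sub]])
    fix m assume m: "m \<in> K"
    then have "m \<in> N \<alpha>" "\<phi> \<alpha> m \<in> V \<inter> ?Q" unfolding K by auto
    then show "(\<psi>' \<circ> ?\<tau> \<circ> inv_into (V \<inter> ?Q) \<psi>) ((\<psi> \<circ> \<phi> \<alpha>) m) = F ((\<psi> \<circ> \<phi> \<alpha>) m)"
      by (simp add: F[OF m] chart_inv[OF mQ cQ] inv_\<phi>[OF a(1)])
  qed
qed

lemma chart_glued_inv:
  assumes "\<alpha> \<in> A" "(V, \<psi>) \<in> charts (X \<alpha>)" "Q \<subseteq> N \<alpha> \<inter> \<phi> \<alpha> -` V" "m \<in> Q"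
  shows "inv_into Q (\<psi> \<circ> \<phi> \<alpha>) (\<psi> (\<phi> \<alpha> m)) = m"
proof -
  have "inj_on (\<psi> \<circ> \<phi> \<alpha>) Q"
    using is_chart_glued[OF assms(1,2)] assms(3) unfolding is_chart_iff by (blast intro: inj_on_subset)
  from inv_into_f_f[OF this assms(4)] show ?thesis by simp
qed

lemma second_countable_glued:
  assumes C: "countable C" "C \<subseteq> A" "\<Union>(N ` C) = \<Union>(N ` A)"
  shows "second_countable (top_of glued)"
proof -
  have "\<forall>\<alpha>\<in>C. \<exists>\<B>. countable \<B> \<and> (\<forall>V\<in>\<B>. openin (top_of (X \<alpha>)) V) \<and>
      (\<forall>U x. openin (top_of (X \<alpha>)) U \<and> x \<in> U \<longrightarrow> (\<exists>V\<in>\<B>. x \<in> V \<and> V \<subseteq> U))"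
    using smooth_manifold_second_countable[OF piece] C(2) unfolding second_countable_def by blast
  from bchoice[OF this] obtain \<B> where
    B: "\<forall>\<alpha>\<in>C. countable (\<B> \<alpha>) \<and> (\<forall>V\<in>\<B> \<alpha>. openin (top_of (X \<alpha>)) V) \<and>
      (\<forall>U x. openin (top_of (X \<alpha>)) U \<and> x \<in> U \<longrightarrow> (\<exists>V\<in>\<B> \<alpha>. x \<in> V \<and> V \<subseteq> U))" by (elim exE)
  let ?D = "\<Union>\<alpha>\<in>C. (\<lambda>V. N \<alpha> \<inter> \<phi> \<alpha> -` V) ` \<B> \<alpha>"
  show ?thesis
    unfolding second_countable_def
  proof (intro exI[of _ ?D] conjI allI impI)
    show "countable ?D" using B C(1) by simp
    show "\<forall>V\<in>?D. openin (top_of glued) V"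
    proof
      fix V assume "V \<in> ?D"
      then obtain \<alpha> P where P: "\<alpha> \<in> C" "P \<in> \<B> \<alpha>" "V = N \<alpha> \<inter> \<phi> \<alpha> -` P" by auto
      have "openin (top_of (X \<alpha>)) P" using B P(1,2) by simp
      then show "openin (top_of glued) V" unfolding P(3) using openin_glued_vimage P(1) C(2) by blast
    qed
    fix U m assume U: "openin (top_of glued) U \<and> m \<in> U"
    then have "m \<in> pts glued" using openin_subset by blast
    then have "m \<in> \<Union>(N ` C)" unfolding pts_glued C(3) .
    then obtain \<alpha> where a: "\<alpha> \<in> C" "m \<in> N \<alpha>" by blast
    then have aA: "\<alpha> \<in> A" using C(2) by blast
    have "openin (top_of (X \<alpha>)) (\<phi> \<alpha> ` (U \<inter> N \<alpha>))"
      using U aA unfolding openin_glued glued_open_def by blast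
    moreover have "\<phi> \<alpha> m \<in> \<phi> \<alpha> ` (U \<inter> N \<alpha>)" using U a by blast
    ultimately have "\<exists>P\<in>\<B> \<alpha>. \<phi> \<alpha> m \<in> P \<and> P \<subseteq> \<phi> \<alpha> ` (U \<inter> N \<alpha>)"
      using B a(1) by simp
    then obtain P where P: "P \<in> \<B> \<alpha>" "\<phi> \<alpha> m \<in> P" "P \<subseteq> \<phi> \<alpha> ` (U \<inter> N \<alpha>)" by blast
    \<comment> \<open>Inclusion of images pulls back to inclusion of sets by injectivity of
      \<open>\<phi> \<alpha>\<close> on \<open>N \<alpha>\<close>.\<close>
    have "N \<alpha> \<inter> \<phi> \<alpha> -` P \<subseteq> U"
    proof
      fix n assume n: "n \<in> N \<alpha> \<inter> \<phi> \<alpha> -` P"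
      then obtain n' where "n' \<in> U \<inter> N \<alpha>" "\<phi> \<alpha> n = \<phi> \<alpha> n'" using P(3) by auto
      then show "n \<in> U" using inj_onD[OF inj[OF aA], of n n'] n by auto
    qed
    moreover have "m \<in> N \<alpha> \<inter> \<phi> \<alpha> -` P" using a P by simp
    moreover have "N \<alpha> \<inter> \<phi> \<alpha> -` P \<in> ?D" using a P by blast
    ultimately show "\<exists>V\<in>?D. m \<in> V \<and> V \<subseteq> U" by blast
  qed
qed

text \<open>Separation and countability are extra hypotheses because gluing can destroy both: two
  lines identified away from the origin form a non-Hausdorff space, and uncountably many disjoint
  nonempty pieces have no countable base.\<close>

lemma smooth_manifold_glued:
  assumes "finite_dimensional TYPE('e)" "Hausdorff_space (top_of glued)"
    and "countable C" "C \<subseteq> A" "\<Union>(N ` C) = \<Union>(N ` A)"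
  shows "smooth_manifold glued"
proof (rule smooth_manifoldI)
  show "second_countable (top_of glued)" by (rule second_countable_glued[OF assms(3-5)])
  show "is_chart (top_of glued) V \<psi>" if c: "(V, \<psi>) \<in> charts glued" for V \<psi>
  proof -
    obtain \<alpha> V\<^sub>0 \<psi>\<^sub>0 where d: "\<alpha> \<in> A" "(V\<^sub>0, \<psi>\<^sub>0) \<in> charts (X \<alpha>)"
      "V = N \<alpha> \<inter> \<phi> \<alpha> -` V\<^sub>0" "\<psi> = \<psi>\<^sub>0 \<circ> \<phi> \<alpha>" using chart_gluedE[OF c] .
    show ?thesis unfolding d(3,4) by (rule is_chart_glued[OF d(1,2)])
  qed
  show "(\<Union>(V, \<psi>)\<in>charts glued. V) = pts glued"
    unfolding pts_glued
  proof (intro equalityI subsetI)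
    fix m assume "m \<in> (\<Union>(V, \<psi>)\<in>charts glued. V)"
    then obtain V \<psi> where V: "(V, \<psi>) \<in> charts glued" "m \<in> V" by auto
    obtain \<alpha> V\<^sub>0 \<psi>\<^sub>0 where "\<alpha> \<in> A" "V = N \<alpha> \<inter> \<phi> \<alpha> -` V\<^sub>0" using chart_gluedE[OF V(1)] by metis
    then show "m \<in> \<Union>(N ` A)" using V(2) by auto
  next
    fix m assume "m \<in> \<Union>(N ` A)"
    then obtain \<alpha> where a: "\<alpha> \<in> A" "m \<in> N \<alpha>" by auto
    then have "\<phi> \<alpha> m \<in> pts (X \<alpha>)" using image_N[OF a(1)] by blast
    then obtain V \<psi> where V: "(V, \<psi>) \<in> charts (X \<alpha>)" "\<phi> \<alpha> m \<in> V" using chart_at[OF piece[OF a(1)]] by blast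
    have "m \<in> N \<alpha> \<inter> \<phi> \<alpha> -` V" using V(2) a(2) by simp
    then show "m \<in> (\<Union>(V, \<psi>)\<in>charts glued. V)"
      by (intro UN_I[OF chart_gluedI[OF a(1) V(1)]]) simp
  qed
  fix V \<psi> P \<rho> assume c: "(V, \<psi>) \<in> charts glued" "(P, \<rho>) \<in> charts glued"
  obtain \<alpha> V\<^sub>0 \<psi>\<^sub>0 where d: "\<alpha> \<in> A" "(V\<^sub>0, \<psi>\<^sub>0) \<in> charts (X \<alpha>)"
    "V = N \<alpha> \<inter> \<phi> \<alpha> -` V\<^sub>0" "\<psi> = \<psi>\<^sub>0 \<circ> \<phi> \<alpha>" using chart_gluedE[OF c(1)] .
  obtain \<beta> P\<^sub>0 \<rho>\<^sub>0 where e: "\<beta> \<in> A" "(P\<^sub>0, \<rho>\<^sub>0) \<in> charts (X \<beta>)"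
    "P = N \<beta> \<inter> \<phi> \<beta> -` P\<^sub>0" "\<rho> = \<rho>\<^sub>0 \<circ> \<phi> \<beta>" using chart_gluedE[OF c(2)] .
  show "smooth_on (\<psi> ` (V \<inter> P)) (\<rho> \<circ> inv_into V \<psi>)"
    unfolding d(4)
  proof (rule smooth_on_glued_overlap[OF d(1,2) e(1,2)])
    show "V \<inter> P = (N \<alpha> \<inter> \<phi> \<alpha> -` V\<^sub>0) \<inter> (N \<beta> \<inter> \<phi> \<beta> -` P\<^sub>0)" using d(3) e(3) by simp
    show "(\<rho> \<circ> inv_into V (\<psi>\<^sub>0 \<circ> \<phi> \<alpha>)) (\<psi>\<^sub>0 (\<phi> \<alpha> m)) = \<rho>\<^sub>0 (\<phi> \<beta> m)" if "m \<in> V \<inter> P" for m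
      using that chart_glued_inv[OF d(1,2), of V m] d(3) e(4) by simp
  qed
qed (rule assms)+

section \<open>Maps into and out of the glued space\<close>

lemma diffeomorphism_glued:
  assumes a: "\<alpha> \<in> A"
  shows "diffeomorphism (open_submfd glued (N \<alpha>)) (X \<alpha>) (\<phi> \<alpha>)"
  unfolding diffeomorphism_def
proof (intro exI[of _ "inv_into (N \<alpha>) (\<phi> \<alpha>)"] conjI ballI)
  show "smooth_map (open_submfd glued (N \<alpha>)) (X \<alpha>) (\<phi> \<alpha>)"
  proof (rule smooth_mapI)
    show "continuous_map (top_of (open_submfd glued (N \<alpha>))) (top_of (X \<alpha>)) (\<phi> \<alpha>)"
      using continuous_map_\<phi>[OF a] by simp
    fix V \<psi> P \<rho> assume c: "(V, \<psi>) \<in> charts (open_submfd glued (N \<alpha>))" "(P, \<rho>) \<in> charts (X \<alpha>)"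
    \<comment> \<open>A chart meeting \<open>N \<alpha>\<close> may come from another piece
      \<open>\<beta>\<close>; in it \<open>\<phi> \<alpha>\<close> is expressed by the transition
      from \<open>\<beta>\<close> to \<open>\<alpha>\<close>.\<close>
    obtain V\<^sub>1 where V\<^sub>1: "(V\<^sub>1, \<psi>) \<in> charts glued" "V = V\<^sub>1 \<inter> N \<alpha>" using chart_open_submfdE[OF c(1)] .
    obtain \<beta> V\<^sub>0 \<psi>\<^sub>0 where d: "\<beta> \<in> A" "(V\<^sub>0, \<psi>\<^sub>0) \<in> charts (X \<beta>)"
      "V\<^sub>1 = N \<beta> \<inter> \<phi> \<beta> -` V\<^sub>0" "\<psi> = \<psi>\<^sub>0 \<circ> \<phi> \<beta>" using chart_gluedE[OF V\<^sub>1(1)] .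
    show "smooth_on (\<psi> ` (V \<inter> \<phi> \<alpha> -` P)) (\<rho> \<circ> \<phi> \<alpha> \<circ> inv_into V \<psi>)"
      unfolding d(4)
    proof (rule smooth_on_glued_overlap[OF d(1,2) a c(2)])
      show "V \<inter> \<phi> \<alpha> -` P = (N \<beta> \<inter> \<phi> \<beta> -` V\<^sub>0) \<inter> (N \<alpha> \<inter> \<phi> \<alpha> -` P)" using d(3) V\<^sub>1(2) by auto
      show "(\<rho> \<circ> \<phi> \<alpha> \<circ> inv_into V (\<psi>\<^sub>0 \<circ> \<phi> \<beta>)) (\<psi>\<^sub>0 (\<phi> \<beta> m)) = \<rho> (\<phi> \<alpha> m)"
        if "m \<in> V \<inter> \<phi> \<alpha> -` P" for m
      proof -
        have "V \<subseteq> N \<beta> \<inter> \<phi> \<beta> -` V\<^sub>0" "m \<in> V" using that d(3) V\<^sub>1(2) by auto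
        from chart_glued_inv[OF d(1,2) this] show ?thesis by simp
      qed
    qed
  qed
  show "smooth_map (X \<alpha>) (open_submfd glued (N \<alpha>)) (inv_into (N \<alpha>) (\<phi> \<alpha>))"
  proof (rule smooth_map_into_open_submfd[OF smooth_mapI])
    let ?g = "inv_into (N \<alpha>) (\<phi> \<alpha>)"
    show "?g x \<in> N \<alpha>" if "x \<in> pts (X \<alpha>)" for x using inv_\<phi>_in[OF a that] .
    show "continuous_map (top_of (X \<alpha>)) (top_of glued) ?g"
      unfolding continuous_map
    proof (intro conjI allI impI)
      show "?g ` pts (X \<alpha>) \<subseteq> pts glued" using inv_\<phi>_in[OF a] a unfolding pts_glued by blast
      fix W assume W: "openin (top_of glued) W"
      have "{x \<in> pts (X \<alpha>). ?g x \<in> W} = \<phi> \<alpha> ` (W \<inter> N \<alpha>)"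
      proof (intro equalityI subsetI)
        fix x assume x: "x \<in> {x \<in> pts (X \<alpha>). ?g x \<in> W}"
        then show "x \<in> \<phi> \<alpha> ` (W \<inter> N \<alpha>)"
          using \<phi>_inv[OF a, of x] inv_\<phi>_in[OF a, of x] by (intro image_eqI[of _ _ "?g x"]) simp_all
      next
        fix x assume "x \<in> \<phi> \<alpha> ` (W \<inter> N \<alpha>)"
        then obtain m where "m \<in> W" "m \<in> N \<alpha>" "x = \<phi> \<alpha> m" by blast
        then show "x \<in> {x \<in> pts (X \<alpha>). ?g x \<in> W}"
          using inv_\<phi>[OF a] image_N[OF a] by auto
      qed
      then show "openin (top_of (X \<alpha>)) {x \<in> pts (X \<alpha>). ?g x \<in> W}"
        using W a unfolding openin_glued glued_open_def by simp
    qed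
    fix V \<psi> P \<rho> assume c: "(V, \<psi>) \<in> charts (X \<alpha>)" "(P, \<rho>) \<in> charts glued"
    obtain \<beta> P\<^sub>0 \<rho>\<^sub>0 where d: "\<beta> \<in> A" "(P\<^sub>0, \<rho>\<^sub>0) \<in> charts (X \<beta>)"
      "P = N \<beta> \<inter> \<phi> \<beta> -` P\<^sub>0" "\<rho> = \<rho>\<^sub>0 \<circ> \<phi> \<beta>" using chart_gluedE[OF c(2)] .
    let ?K = "(N \<alpha> \<inter> \<phi> \<alpha> -` V) \<inter> (N \<beta> \<inter> \<phi> \<beta> -` P\<^sub>0)"
    have "smooth_on ((\<psi> \<circ> \<phi> \<alpha>) ` ?K) (\<rho> \<circ> ?g \<circ> inv_into V \<psi>)"
      by (rule smooth_on_glued_overlap[OF a c(1) d(1,2) refl])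
        (simp add: d(4) chart_inv[OF piece[OF a] c(1)] inv_\<phi>[OF a])
    moreover have "V \<inter> ?g -` P \<subseteq> \<phi> \<alpha> ` ?K"
    proof
      fix x assume x: "x \<in> V \<inter> ?g -` P"
      then have "x \<in> pts (X \<alpha>)" using chart_subset[OF piece[OF a] c(1)] by blast
      then have "\<phi> \<alpha> (?g x) = x" "?g x \<in> N \<alpha>" using \<phi>_inv[OF a] inv_\<phi>_in[OF a] by simp_all
      then show "x \<in> \<phi> \<alpha> ` ?K" using x d(3) by (intro image_eqI[of _ _ "?g x"]) simp_all
    qed
    then have "\<psi> ` (V \<inter> ?g -` P) \<subseteq> (\<psi> \<circ> \<phi> \<alpha>) ` ?K" unfolding image_comp[symmetric] by (rule image_mono)
    ultimately show "smooth_on (\<psi> ` (V \<inter> ?g -` P)) (\<rho> \<circ> ?g \<circ> inv_into V \<psi>)"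
      by (rule smooth_on_subset)
  qed
  show "inv_into (N \<alpha>) (\<phi> \<alpha>) (\<phi> \<alpha> m) = m" if "m \<in> pts (open_submfd glued (N \<alpha>))" for m
    using that inv_\<phi>[OF a] by simp
  show "\<phi> \<alpha> (inv_into (N \<alpha>) (\<phi> \<alpha>) x) = x" if "x \<in> pts (X \<alpha>)" for x
    using \<phi>_inv[OF a that] .
qed

lemma smooth_map_\<phi>: "\<alpha> \<in> A \<Longrightarrow> smooth_map (open_submfd glued (N \<alpha>)) (X \<alpha>) (\<phi> \<alpha>)"
  using diffeomorphism_glued unfolding diffeomorphism_def by blast

text \<open>The \<open>F \<alpha>\<close> are the coordinate forms of \<open>f\<close>. For the
  bundle projection every one of them is the first projection \<open>fst\<close>.\<close>

lemma smooth_map_from_glued: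
  assumes "smooth_manifold glued" "smooth_manifold Y"
    and F: "\<And>\<alpha>. \<alpha> \<in> A \<Longrightarrow> smooth_map (X \<alpha>) Y (F \<alpha>)"
    and f: "\<And>\<alpha> m. \<alpha> \<in> A \<Longrightarrow> m \<in> N \<alpha> \<Longrightarrow> F \<alpha> (\<phi> \<alpha> m) = f m"
  shows "smooth_map glued Y f"
proof (rule smooth_map_locally[OF assms(1,2)])
  fix m assume "m \<in> pts glued"
  then obtain \<alpha> where a: "\<alpha> \<in> A" "m \<in> N \<alpha>" unfolding pts_glued by blast
  note mN = smooth_manifold_open_submfd[OF assms(1) openin_N[OF a(1)]]
  have "smooth_map (open_submfd glued (N \<alpha>)) Y (\<lambda>m. F \<alpha> (\<phi> \<alpha> m))"
    by (rule smooth_map_compose[OF mN piece[OF a(1)] assms(2) smooth_map_\<phi>[OF a(1)] F[OF a(1)]])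
  then have "smooth_map (open_submfd glued (N \<alpha>)) Y f"
    by (rule smooth_map_cong[OF mN assms(2)]) (simp add: f[OF a(1)])
  then show "\<exists>N. openin (top_of glued) N \<and> m \<in> N \<and> smooth_map (open_submfd glued N) Y f"
    using openin_N[OF a(1)] a(2) by blast
qed

text \<open>Stated apart from the smooth version because it serves to prove the Hausdorff property,
  before \<open>smooth_manifold glued\<close> is available.\<close>

lemma continuous_map_from_glued:
  assumes F: "\<And>\<alpha>. \<alpha> \<in> A \<Longrightarrow> continuous_map (top_of (X \<alpha>)) T (F \<alpha>)"
    and f: "\<And>\<alpha> m. \<alpha> \<in> A \<Longrightarrow> m \<in> N \<alpha> \<Longrightarrow> F \<alpha> (\<phi> \<alpha> m) = f m"
  shows "continuous_map (top_of glued) T f"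
  unfolding continuous_map
proof (intro conjI allI impI)
  show "f ` pts glued \<subseteq> topspace T"
  proof clarify
    fix m assume "m \<in> pts glued"
    then obtain \<alpha> where a: "\<alpha> \<in> A" "m \<in> N \<alpha>" unfolding pts_glued by blast
    have "\<phi> \<alpha> m \<in> pts (X \<alpha>)" using image_N[OF a(1)] a(2) by blast
    then show "f m \<in> topspace T"
      using continuous_map_image_subset_topspace[OF F[OF a(1)]] unfolding f[OF a, symmetric] by blast
  qed
  fix V assume V: "openin T V"
  have "openin (top_of (X \<alpha>)) (\<phi> \<alpha> ` ({m \<in> pts glued. f m \<in> V} \<inter> N \<alpha>))" if a: "\<alpha> \<in> A" for \<alpha>
  proof -
    have "\<phi> \<alpha> ` ({m \<in> pts glued. f m \<in> V} \<inter> N \<alpha>) = {x \<in> \<phi> \<alpha> ` N \<alpha>. F \<alpha> x \<in> V}"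
      using f[OF a] a unfolding pts_glued by auto
    then show ?thesis using openin_continuous_map_preimage[OF F[OF a] V] image_N[OF a] by simp
  qed
  then show "openin (top_of glued) {m \<in> pts glued. f m \<in> V}"
    unfolding openin_glued glued_open_def pts_glued by blast
qed

lemma Hausdorff_glued:
  assumes T: "Hausdorff_space T" and \<pi>: "continuous_map (top_of glued) T \<pi>"
    and fib: "\<And>m n. m \<in> pts glued \<Longrightarrow> n \<in> pts glued \<Longrightarrow> \<pi> m = \<pi> n \<Longrightarrow> \<exists>\<alpha>\<in>A. m \<in> N \<alpha> \<and> n \<in> N \<alpha>"
  shows "Hausdorff_space (top_of glued)"
  unfolding Hausdorff_space_def
proof (intro allI impI)
  fix m n assume mn: "m \<in> pts glued \<and> n \<in> pts glued \<and> m \<noteq> n"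
  show "\<exists>U V. openin (top_of glued) U \<and> openin (top_of glued) V \<and> m \<in> U \<and> n \<in> V \<and> disjnt U V"
  proof (cases "\<pi> m = \<pi> n")
    case True
    then obtain \<alpha> where a: "\<alpha> \<in> A" "m \<in> N \<alpha>" "n \<in> N \<alpha>" using fib[of m n] mn by blast
    have "\<phi> \<alpha> m \<noteq> \<phi> \<alpha> n" using inj_onD[OF inj[OF a(1)] _ a(2,3)] mn by blast
    moreover have "\<phi> \<alpha> m \<in> pts (X \<alpha>)" "\<phi> \<alpha> n \<in> pts (X \<alpha>)" using image_N[OF a(1)] a(2,3) by blast+
    ultimately obtain P Q where PQ: "openin (top_of (X \<alpha>)) P" "openin (top_of (X \<alpha>)) Q"
      "\<phi> \<alpha> m \<in> P" "\<phi> \<alpha> n \<in> Q" "disjnt P Q"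
      using smooth_manifold_Hausdorff[OF piece[OF a(1)]] unfolding Hausdorff_space_def by meson
    show ?thesis
      by (intro exI[of _ "N \<alpha> \<inter> \<phi> \<alpha> -` P"] exI[of _ "N \<alpha> \<inter> \<phi> \<alpha> -` Q"] conjI
          openin_glued_vimage[OF a(1)]) (use PQ a in \<open>auto simp: disjnt_iff\<close>)
  next
    case False
    have "\<pi> m \<in> topspace T" "\<pi> n \<in> topspace T"
      using continuous_map_image_subset_topspace[OF \<pi>] mn by blast+
    then obtain P Q where PQ: "openin T P" "openin T Q" "\<pi> m \<in> P" "\<pi> n \<in> Q" "disjnt P Q"
      using T False unfolding Hausdorff_space_def by meson
    show ?thesis
      by (intro exI[of _ "{m \<in> pts glued. \<pi> m \<in> P}"] exI[of _ "{m \<in> pts glued. \<pi> m \<in> Q}"] conjI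
          openin_continuous_map_preimage[OF \<pi>]) (use PQ mn in \<open>auto simp: disjnt_iff\<close>)
  qed
qed

end

section \<open>Cocycles acting on a fiber\<close>

text \<open>The data \<open>(H, S, h)\<close> and \<open>(F, W, f)\<close> play the same role, so
  one fiber factor is treated here and the locale is instantiated twice over a common base and
  cover.\<close>

locale cocycle_action =
  fixes G :: "'g monoid" and G_mfd :: "('g, 'd::real_normed_vector) mfd"
    and B :: "('b, 'be::real_normed_vector) mfd" and S :: "('s, 'se::real_normed_vector) mfd"
    and act :: "'g \<Rightarrow> 's \<Rightarrow> 's"
    and A :: "'i set" and U :: "'i \<Rightarrow> 'b set" and c :: "'i \<Rightarrow> 'i \<Rightarrow> 'b \<Rightarrow> 'g"
  assumes B: "smooth_manifold B" and S: "smooth_manifold S"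
    and lie: "lie_group G G_mfd" and action: "smooth_left_action G G_mfd S act"
    and cover: "open_cover B A U" and cocycle: "cocycle G G_mfd B A U c"
begin

text \<open>The change of fiber coordinate over \<open>p\<close> from index \<open>\<beta>\<close>
  to index \<open>\<alpha>\<close>.\<close>

abbreviation tr :: "'i \<Rightarrow> 'i \<Rightarrow> 'b \<Rightarrow> 's \<Rightarrow> 's" where "tr \<alpha> \<beta> p \<equiv> act (c \<alpha> \<beta> p)"

lemma group_action: "group_action G (pts S) act"
  using action by (simp add: smooth_left_action_def)

lemma openin_U: "\<alpha> \<in> A \<Longrightarrow> openin (top_of B) (U \<alpha>)"
  using cover by (simp add: open_cover_def)

lemma openin_overlap: "\<alpha> \<in> A \<Longrightarrow> \<beta> \<in> A \<Longrightarrow> openin (top_of B) (U \<alpha> \<inter> U \<beta>)"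
  by (simp add: openin_Int openin_U)

lemma U_subset: "\<alpha> \<in> A \<Longrightarrow> U \<alpha> \<subseteq> pts B"
  by (rule openin_subset[OF openin_U])

lemma cocycle_smooth:
  assumes "\<alpha> \<in> A" "\<beta> \<in> A" "U \<alpha> \<inter> U \<beta> \<noteq> {}"
  shows "smooth_map (open_submfd B (U \<alpha> \<inter> U \<beta>)) G_mfd (c \<alpha> \<beta>)"
proof -
  have "\<forall>\<alpha>\<in>A. \<forall>\<beta>\<in>A. U \<alpha> \<inter> U \<beta> \<noteq> {} \<longrightarrow>
      smooth_map (open_submfd B (U \<alpha> \<inter> U \<beta>)) G_mfd (c \<alpha> \<beta>)"
    using cocycle unfolding cocycle_def by (elim conjE)
  then show ?thesis using assms by blast
qed

text \<open>Values lie in the group because smoothness includes mapping points to points, and the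
  points of \<open>G_mfd\<close> are the carrier of \<open>G\<close>.\<close>

lemma cocycle_carrier:
  assumes "\<alpha> \<in> A" "\<beta> \<in> A" "p \<in> U \<alpha>" "p \<in> U \<beta>"
  shows "c \<alpha> \<beta> p \<in> carrier G"
proof -
  have "U \<alpha> \<inter> U \<beta> \<noteq> {}" using assms by blast
  from smooth_map_pts[OF cocycle_smooth[OF assms(1,2) this], of p]
  show ?thesis using lie assms U_subset[OF assms(1)] by (auto simp: lie_group_def)
qed

lemma tr_in:
  assumes "\<alpha> \<in> A" "\<beta> \<in> A" "p \<in> U \<alpha>" "p \<in> U \<beta>" "x \<in> pts S"
  shows "tr \<alpha> \<beta> p x \<in> pts S"
  using group_action.element_image[OF group_action cocycle_carrier[OF assms(1-4)] assms(5) refl] .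

lemma tr_id:
  assumes "\<alpha> \<in> A" "p \<in> U \<alpha>" "x \<in> pts S"
  shows "tr \<alpha> \<alpha> p x = x"
proof -
  have "\<forall>\<alpha>\<in>A. \<forall>p \<in> U \<alpha>. c \<alpha> \<alpha> p = \<one>\<^bsub>G\<^esub>"
    using cocycle unfolding cocycle_def by (elim conjE)
  then have "c \<alpha> \<alpha> p = \<one>\<^bsub>G\<^esub>" using assms by blast
  then show ?thesis using fun_cong[OF group_action.id_eq_one[OF group_action], of x] assms(3) by simp
qed

lemma tr_tr:
  assumes "\<alpha> \<in> A" "\<beta> \<in> A" "\<gamma> \<in> A" "p \<in> U \<alpha>" "p \<in> U \<beta>" "p \<in> U \<gamma>" "x \<in> pts S"
  shows "tr \<alpha> \<beta> p (tr \<beta> \<gamma> p x) = tr \<alpha> \<gamma> p x"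
proof -
  have "\<forall>\<alpha>\<in>A. \<forall>\<beta>\<in>A. \<forall>\<gamma>\<in>A. \<forall>p \<in> U \<alpha> \<inter> U \<beta> \<inter> U \<gamma>.
      c \<alpha> \<beta> p \<otimes>\<^bsub>G\<^esub> c \<beta> \<gamma> p = c \<alpha> \<gamma> p"
    using cocycle unfolding cocycle_def by (elim conjE)
  then have "c \<alpha> \<beta> p \<otimes>\<^bsub>G\<^esub> c \<beta> \<gamma> p = c \<alpha> \<gamma> p" using assms by blast
  then show ?thesis
    using group_action.composition_rule[OF group_action assms(7) cocycle_carrier[OF assms(1,2,4,5)]
        cocycle_carrier[OF assms(2,3,5,6)]] by simp
qed

text \<open>The two maps are mutually inverse by the cocycle identity along the paths \<alpha>,
  \<beta>, \<alpha> and \<beta>, \<alpha>, \<beta>.\<close>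

lemma tr_eq_iff:
  assumes "\<alpha> \<in> A" "\<beta> \<in> A" "p \<in> U \<alpha>" "p \<in> U \<beta>" "x \<in> pts S" "y \<in> pts S"
  shows "x = tr \<alpha> \<beta> p y \<longleftrightarrow> y = tr \<beta> \<alpha> p x"
  using tr_tr[OF assms(1,2,1) assms(3,4,3) assms(5)] tr_tr[OF assms(2,1,2) assms(4,3,4) assms(6)]
    tr_id[OF assms(1,3,5)] tr_id[OF assms(2,4,6)] by auto

text \<open>The map factors through \<open>G_mfd \<times>\<^sub>M S\<close> as a pair followed by
  the action. The parameter manifold \<open>Z\<close> is later an overlap inside a local product,
  with \<open>P\<close> and \<open>Q\<close> its base and fiber coordinates.\<close>

lemma smooth_map_tr:
  assumes Z: "smooth_manifold Z" and ab: "\<alpha> \<in> A" "\<beta> \<in> A"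
    and P: "smooth_map Z B P" "\<And>z. z \<in> pts Z \<Longrightarrow> P z \<in> U \<alpha> \<inter> U \<beta>" and Q: "smooth_map Z S Q"
  shows "smooth_map Z S (\<lambda>z. tr \<alpha> \<beta> (P z) (Q z))"
proof (cases "U \<alpha> \<inter> U \<beta> = {}")
  \<comment> \<open>The cocycle is only required to be smooth on nonempty overlaps; over an empty
    one \<open>Z\<close> has no points and every map on it agrees with \<open>Q\<close>.\<close>
  case True
  then have "pts Z = {}" using P(2) by blast
  then show ?thesis by (intro smooth_map_cong[OF Z S Q]) simp
next
  case False
  have Gm: "smooth_manifold G_mfd" using lie by (simp add: lie_group_def)
  note O = smooth_manifold_open_submfd[OF B openin_overlap[OF ab]]
  have "smooth_map Z G_mfd (\<lambda>z. c \<alpha> \<beta> (P z))"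
    by (rule smooth_map_compose[OF Z O Gm smooth_map_into_open_submfd[OF P] cocycle_smooth[OF ab False]])
  from smooth_map_Pair[OF Z Gm S this Q]
  have 1: "smooth_map Z (G_mfd \<times>\<^sub>M S) (\<lambda>z. (c \<alpha> \<beta> (P z), Q z))" .
  have 2: "smooth_map (G_mfd \<times>\<^sub>M S) S (\<lambda>(g, x). act g x)"
    using action by (simp add: smooth_left_action_def)
  from smooth_map_compose[OF Z smooth_manifold_prod_mfd[OF Gm S] S 1 2] show ?thesis by simp
qed

end

text \<open>The Lindelof property yields countably many sets of the cover; one index is then chosen
  for each, since different indices may carry the same set.\<close>

lemma countable_subcover:
  assumes "second_countable (top_of B)" "open_cover B A U"
  shows "\<exists>C. countable C \<and> C \<subseteq> A \<and> (\<Union>\<alpha>\<in>C. U \<alpha>) = pts B"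
proof -
  have 1: "\<forall>V\<in>U ` A. openin (top_of B) V" and 2: "\<Union>(U ` A) = pts B"
    using assms(2) by (simp_all add: open_cover_def)
  have "\<exists>\<V>. countable \<V> \<and> \<V> \<subseteq> U ` A \<and> \<Union>\<V> = pts B"
    using second_countable_imp_Lindelof_space[OF assms(1)] 1 2 unfolding Lindelof_space_def by simp
  then obtain \<V> where V: "countable \<V>" "\<V> \<subseteq> U ` A" "\<Union>\<V> = pts B" by (elim exE conjE)
  obtain C where C: "countable C" "C \<subseteq> A" "\<V> = U ` C"
    using iffD1[OF countable_subset_image conjI[OF V(1,2)]] by (elim exE conjE)
  show ?thesis using C V(3) by (intro exI[of _ C]) simp
qed

section \<open>The bundle glued from two cocycles\<close>

locale cocycle_gluing =
  s: cocycle_action H H_mfd B S act\<^sub>S A U h + w: cocycle_action F F_mfd B W act\<^sub>W A U f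
  for H :: "'h monoid" and H_mfd :: "('h, 'he::real_normed_vector) mfd"
    and B :: "('b, 'be::real_normed_vector) mfd" and S :: "('s, 'se::real_normed_vector) mfd"
    and act\<^sub>S :: "'h \<Rightarrow> 's \<Rightarrow> 's" and A :: "'i set" and U :: "'i \<Rightarrow> 'b set"
    and h :: "'i \<Rightarrow> 'i \<Rightarrow> 'b \<Rightarrow> 'h" and F :: "'f monoid"
    and F_mfd :: "('f, 'fe::real_normed_vector) mfd" and W :: "('w, 'we::real_normed_vector) mfd"
    and act\<^sub>W :: "'f \<Rightarrow> 'w \<Rightarrow> 'w" and f :: "'i \<Rightarrow> 'i \<Rightarrow> 'b \<Rightarrow> 'f"
begin

section \<open>The equivalence relation and its classes\<close>

definition total_space :: "('i \<times> 'b \<times> 's \<times> 'w) set" where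
  "total_space = glue_total A U (pts S) (pts W)"

definition R :: "(('i \<times> 'b \<times> 's \<times> 'w) \<times> ('i \<times> 'b \<times> 's \<times> 'w)) set" where
  "R = glue_rel A U (pts S) (pts W) act\<^sub>S h act\<^sub>W f"

abbreviation cls :: "'i \<Rightarrow> 'b \<Rightarrow> 's \<Rightarrow> 'w \<Rightarrow> ('i \<times> 'b \<times> 's \<times> 'w) set" where
  "cls \<alpha> p x y \<equiv> R `` {(\<alpha>, p, x, y)}"

lemma total_space_iff: "(\<alpha>, p, x, y) \<in> total_space \<longleftrightarrow> \<alpha> \<in> A \<and> p \<in> U \<alpha> \<and> x \<in> pts S \<and> y \<in> pts W"
  by (simp add: total_space_def glue_total_def)

lemma R_iff: "((\<alpha>, p, x, y), (\<beta>, p', x', y')) \<in> R \<longleftrightarrow>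
    (\<alpha>, p, x, y) \<in> total_space \<and> (\<beta>, p', x', y') \<in> total_space \<and> p' = p \<and>
    x = s.tr \<alpha> \<beta> p x' \<and> y = w.tr \<alpha> \<beta> p y'"
  by (auto simp: R_def glue_rel_def total_space_def)

text \<open>Solved for the second point, the relation shows that a class over \<open>p\<close>
  contains exactly one point of each index \<open>\<beta>\<close> with
  \<open>p \<in> U \<beta>\<close>. Well-definedness of \<open>glue_chart\<close> rests on
  this.\<close>

lemma R_iff': "((\<alpha>, p, x, y), (\<beta>, p', x', y')) \<in> R \<longleftrightarrow>
    (\<alpha>, p, x, y) \<in> total_space \<and> \<beta> \<in> A \<and> p \<in> U \<beta> \<and> p' = p \<and>
    x' = s.tr \<beta> \<alpha> p x \<and> y' = w.tr \<beta> \<alpha> p y"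
proof (cases "\<alpha> \<in> A \<and> \<beta> \<in> A \<and> p \<in> U \<alpha> \<and> p \<in> U \<beta> \<and> x \<in> pts S \<and> y \<in> pts W")
  case True
  then have a: "\<alpha> \<in> A" "\<beta> \<in> A" "p \<in> U \<alpha>" "p \<in> U \<beta>" "x \<in> pts S" "y \<in> pts W" by simp_all
  have "x' \<in> pts S \<and> x = s.tr \<alpha> \<beta> p x' \<longleftrightarrow> x' = s.tr \<beta> \<alpha> p x"
    using s.tr_eq_iff[OF a(1-5)] s.tr_in[OF a(2,1,4,3,5)] by blast
  moreover have "y' \<in> pts W \<and> y = w.tr \<alpha> \<beta> p y' \<longleftrightarrow> y' = w.tr \<beta> \<alpha> p y"
    using w.tr_eq_iff[OF a(1-4,6)] w.tr_in[OF a(2,1,4,3,6)] by blast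
  ultimately show ?thesis using a by (auto simp: R_iff total_space_iff)
next
  case False
  then show ?thesis by (auto simp: R_iff total_space_iff)
qed

lemma equiv_R: "equiv total_space R"
proof (rule equivI)
  show "R \<subseteq> total_space \<times> total_space" unfolding R_def total_space_def glue_rel_def by auto
  show "refl_on total_space R"
  proof (rule refl_onI)
    fix z assume z: "z \<in> total_space"
    obtain \<alpha> p x y where e: "z = (\<alpha>, p, x, y)" by (cases z)
    show "(z, z) \<in> R" using z unfolding e R_iff total_space_iff by (simp add: s.tr_id w.tr_id)
  qed
  show "sym R"
  proof (rule symI)
    fix z z' assume z: "(z, z') \<in> R"
    obtain \<alpha> p x y where e: "z = (\<alpha>, p, x, y)" by (cases z)
    obtain \<beta> p' x' y' where e': "z' = (\<beta>, p', x', y')" by (cases z')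
    have p: "p' = p" using z unfolding e e' R_iff by (elim conjE)
    \<comment> \<open>The same pair is read in both forms: one supplies the memberships, the other
      the equations with the roles exchanged.\<close>
    note R = z[unfolded e e' p R_iff] and R' = z[unfolded e e' p R_iff']
    have t: "(\<alpha>, p, x, y) \<in> total_space" "(\<beta>, p, x', y') \<in> total_space"
      using R[THEN conjunct1] R[THEN conjunct2, THEN conjunct1] .
    have "x' = s.tr \<beta> \<alpha> p x" "y' = w.tr \<beta> \<alpha> p y"
      using R'[THEN conjunct2, THEN conjunct2, THEN conjunct2, THEN conjunct2, THEN conjunct1]
        R'[THEN conjunct2, THEN conjunct2, THEN conjunct2, THEN conjunct2, THEN conjunct2] .
    then show "(z', z) \<in> R" unfolding e e' p R_iff by (intro conjI t refl)
  qed
  show "trans R"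
  proof (rule transI)
    fix z z' z'' assume z: "(z, z') \<in> R" "(z', z'') \<in> R"
    obtain \<alpha> p x y where e: "z = (\<alpha>, p, x, y)" by (cases z)
    obtain \<beta> p' x' y' where e': "z' = (\<beta>, p', x', y')" by (cases z')
    obtain \<gamma> p'' x'' y'' where e'': "z'' = (\<gamma>, p'', x'', y'')" by (cases z'')
    have p: "p' = p" using z(1) unfolding e e' R_iff by (elim conjE)
    have p': "p'' = p" using z(2) unfolding e' e'' R_iff p by (elim conjE)
    note z1 = z(1)[unfolded e e' p R_iff] and z2 = z(2)[unfolded e' e'' p p' R_iff]
    note 1 = z1[THEN conjunct1] z1[THEN conjunct2, THEN conjunct1]
      z1[THEN conjunct2, THEN conjunct2, THEN conjunct2, THEN conjunct1]
      z1[THEN conjunct2, THEN conjunct2, THEN conjunct2, THEN conjunct2]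
    note 2 = z2[THEN conjunct2, THEN conjunct1]
      z2[THEN conjunct2, THEN conjunct2, THEN conjunct2, THEN conjunct1]
      z2[THEN conjunct2, THEN conjunct2, THEN conjunct2, THEN conjunct2]
    have "x = s.tr \<alpha> \<gamma> p x''"
      unfolding 1(3) 2(2) by (rule s.tr_tr) (use 1(1,2) 2(1) in \<open>simp_all add: total_space_iff\<close>)
    moreover have "y = w.tr \<alpha> \<gamma> p y''"
      unfolding 1(4) 2(3) by (rule w.tr_tr) (use 1(1,2) 2(1) in \<open>simp_all add: total_space_iff\<close>)
    ultimately show "(z, z'') \<in> R" unfolding e e'' p' R_iff by (intro conjI 1(1) 2(1) refl)
  qed
qed

lemma cls_iff:
  assumes "(\<alpha>, p, x, y) \<in> total_space"
  shows "(\<beta>, p', x', y') \<in> cls \<alpha> p x y \<longleftrightarrow>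
    \<beta> \<in> A \<and> p \<in> U \<beta> \<and> p' = p \<and> x' = s.tr \<beta> \<alpha> p x \<and> y' = w.tr \<beta> \<alpha> p y"
  using assms by (simp add: R_iff')

lemma glue_proj_cls:
  assumes "(\<alpha>, p, x, y) \<in> total_space"
  shows "glue_proj (cls \<alpha> p x y) = p"
  unfolding glue_proj_def
proof (rule the_equality)
  have "(\<alpha>, p, x, y) \<in> cls \<alpha> p x y" by (rule equiv_class_self[OF equiv_R assms])
  then show "\<exists>\<beta> x' y'. (\<beta>, p, x', y') \<in> cls \<alpha> p x y" by blast
  show "p' = p" if "\<exists>\<beta> x' y'. (\<beta>, p', x', y') \<in> cls \<alpha> p x y" for p'
    using that unfolding cls_iff[OF assms] by blast
qed

lemma cls_mem_iff:
  assumes "(\<alpha>, p, x, y) \<in> total_space" "\<beta> \<in> A" "p \<in> U \<beta>"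
  shows "(\<beta>, q) \<in> cls \<alpha> p x y \<longleftrightarrow> q = (p, s.tr \<beta> \<alpha> p x, w.tr \<beta> \<alpha> p y)"
proof -
  obtain p' x' y' where "q = (p', x', y')" by (cases q)
  then show ?thesis using cls_iff[OF assms(1), of \<beta> p' x' y'] assms(2,3) by simp
qed

lemma glue_chart_cls:
  assumes "(\<alpha>, p, x, y) \<in> total_space" "\<beta> \<in> A" "p \<in> U \<beta>"
  shows "glue_chart \<beta> (cls \<alpha> p x y) = (p, s.tr \<beta> \<alpha> p x, w.tr \<beta> \<alpha> p y)"
  unfolding glue_chart_def cls_mem_iff[OF assms] by simp

lemma glue_chart_cls_same:
  assumes "(\<alpha>, p, x, y) \<in> total_space"
  shows "glue_chart \<alpha> (cls \<alpha> p x y) = (p, x, y)"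
  using glue_chart_cls[OF assms, of \<alpha>] assms by (simp add: total_space_iff s.tr_id w.tr_id)

lemma cls_in_quotient: "(\<alpha>, p, x, y) \<in> total_space \<Longrightarrow> cls \<alpha> p x y \<in> total_space // R"
  by (rule quotientI)

text \<open>A class is presented by a representative of some index \<open>\<beta>\<close>;
  transporting it by the maps \<open>tr \<alpha> \<beta> p\<close> gives one of the prescribed
  index.\<close>

lemma quotient_in_chart:
  assumes m: "m \<in> total_space // R" and a: "\<alpha> \<in> A" "glue_proj m \<in> U \<alpha>"
  obtains x y where "(\<alpha>, glue_proj m, x, y) \<in> total_space" "m = cls \<alpha> (glue_proj m) x y"
proof -
  obtain z where z: "m = R `` {z}" "z \<in> total_space" using m by (rule quotientE)
  obtain \<beta> p x y where e: "z = (\<beta>, p, x, y)" by (cases z)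
  have t: "(\<beta>, p, x, y) \<in> total_space" using z(2) e by simp
  have p: "glue_proj m = p" using glue_proj_cls[OF t] z(1) e by simp
  have "((\<beta>, p, x, y), (\<alpha>, p, s.tr \<alpha> \<beta> p x, w.tr \<alpha> \<beta> p y)) \<in> R"
    using t a p by (simp add: R_iff')
  note r = this
  have "(\<alpha>, p, s.tr \<alpha> \<beta> p x, w.tr \<alpha> \<beta> p y) \<in> total_space"
    using r unfolding R_iff by simp
  moreover have "m = cls \<alpha> p (s.tr \<alpha> \<beta> p x) (w.tr \<alpha> \<beta> p y)"
    unfolding z(1) e by (rule equiv_class_eq[OF equiv_R r])
  ultimately show thesis using that p by simp
qed

lemma quotient_proj:
  assumes "m \<in> total_space // R"
  obtains \<alpha> where "\<alpha> \<in> A" "glue_proj m \<in> U \<alpha>"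
proof -
  obtain z where z: "m = R `` {z}" "z \<in> total_space" using assms by (rule quotientE)
  obtain \<alpha> p x y where e: "z = (\<alpha>, p, x, y)" by (cases z)
  show thesis using that[of \<alpha>] glue_proj_cls[of \<alpha> p x y] z e by (simp add: total_space_iff)
qed

section \<open>Local products and their transition maps\<close>

text \<open>This is the preimage of \<open>U \<alpha>\<close> under the projection, written on the
  bare quotient because its manifold structure is still to be built; \<open>preim_glue_proj\<close>
  identifies the two.\<close>

definition N :: "'i \<Rightarrow> ('i \<times> 'b \<times> 's \<times> 'w) set set" where
  "N \<alpha> = {m \<in> total_space // R. glue_proj m \<in> U \<alpha>}"

text \<open>Associated to the right, this is literally the target that \<open>bundle_chart\<close>
  prescribes for the fiber \<open>S \<times>\<^sub>M W\<close>.\<close>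

definition X :: "'i \<Rightarrow> ('b \<times> 's \<times> 'w, 'be \<times> 'se \<times> 'we) mfd" where
  "X \<alpha> = open_submfd B (U \<alpha>) \<times>\<^sub>M S \<times>\<^sub>M W"

lemma cls_in_N: "(\<alpha>, p, x, y) \<in> total_space \<Longrightarrow> cls \<alpha> p x y \<in> N \<alpha>"
  using cls_in_quotient glue_proj_cls unfolding N_def by (simp add: total_space_iff)

lemma N_cases:
  assumes "\<alpha> \<in> A" "m \<in> N \<alpha>"
  obtains x y where "(\<alpha>, glue_proj m, x, y) \<in> total_space" "m = cls \<alpha> (glue_proj m) x y"
    "glue_chart \<alpha> m = (glue_proj m, x, y)"
proof -
  have m: "m \<in> total_space // R" "glue_proj m \<in> U \<alpha>" using assms(2) by (simp_all add: N_def)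
  obtain x y where xy: "(\<alpha>, glue_proj m, x, y) \<in> total_space" "m = cls \<alpha> (glue_proj m) x y"
    using quotient_in_chart[OF m(1) assms(1) m(2)] .
  have "glue_chart \<alpha> m = (glue_proj m, x, y)" using glue_chart_cls_same[OF xy(1)] xy(2) by simp
  with xy show thesis by (rule that)
qed

lemma fst_glue_chart: "\<alpha> \<in> A \<Longrightarrow> m \<in> N \<alpha> \<Longrightarrow> fst (glue_chart \<alpha> m) = glue_proj m"
  by (erule (1) N_cases) simp

lemma smooth_manifold_X: "\<alpha> \<in> A \<Longrightarrow> smooth_manifold (X \<alpha>)"
  unfolding X_def
  by (intro smooth_manifold_prod_mfd smooth_manifold_open_submfd s.B s.S w.S s.openin_U)

lemma pts_X: "\<alpha> \<in> A \<Longrightarrow> pts (X \<alpha>) = U \<alpha> \<times> pts S \<times> pts W"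
  using s.U_subset by (simp add: X_def Int_absorb1)

lemma pts_X_iff: "\<alpha> \<in> A \<Longrightarrow> (p, x, y) \<in> pts (X \<alpha>) \<longleftrightarrow> (\<alpha>, p, x, y) \<in> total_space"
  by (simp add: pts_X total_space_iff)

lemma bij_glue_chart:
  assumes a: "\<alpha> \<in> A"
  shows "bij_betw (glue_chart \<alpha>) (N \<alpha>) (pts (X \<alpha>))"
proof (rule bij_betwI)
  let ?g = "\<lambda>(p, x, y). cls \<alpha> p x y"
  show "glue_chart \<alpha> \<in> N \<alpha> \<rightarrow> pts (X \<alpha>)"
  proof
    fix m assume m: "m \<in> N \<alpha>"
    show "glue_chart \<alpha> m \<in> pts (X \<alpha>)" by (rule N_cases[OF a m]) (simp add: pts_X_iff[OF a])
  qed
  show "?g \<in> pts (X \<alpha>) \<rightarrow> N \<alpha>"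
  proof
    fix z assume z: "z \<in> pts (X \<alpha>)"
    obtain p x y where e: "z = (p, x, y)" by (cases z)
    show "?g z \<in> N \<alpha>" using cls_in_N z unfolding e pts_X_iff[OF a] by simp
  qed
  show "?g (glue_chart \<alpha> m) = m" if "m \<in> N \<alpha>" for m
    by (rule N_cases[OF a that]) simp
  show "glue_chart \<alpha> (?g z) = z" if z: "z \<in> pts (X \<alpha>)" for z
  proof -
    obtain p x y where e: "z = (p, x, y)" by (cases z)
    show ?thesis using glue_chart_cls_same z unfolding e pts_X_iff[OF a] by simp
  qed
qed

text \<open>The inverse chart is the formation of classes, which makes the transition maps
  computable.\<close>

lemma inv_glue_chart:
  assumes "(\<alpha>, p, x, y) \<in> total_space"
  shows "inv_into (N \<alpha>) (glue_chart \<alpha>) (p, x, y) = cls \<alpha> p x y"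
proof -
  have "\<alpha> \<in> A" using assms by (simp add: total_space_iff)
  from inv_into_f_f[OF bij_betw_imp_inj_on[OF bij_glue_chart[OF this]] cls_in_N[OF assms]]
  show ?thesis by (simp only: glue_chart_cls_same[OF assms])
qed

lemma glue_chart_overlap:
  assumes a: "\<alpha> \<in> A" and b: "\<beta> \<in> A"
  shows "glue_chart \<alpha> ` (N \<alpha> \<inter> N \<beta>) = (U \<alpha> \<inter> U \<beta>) \<times> pts S \<times> pts W"
proof (intro equalityI subsetI)
  fix z assume "z \<in> glue_chart \<alpha> ` (N \<alpha> \<inter> N \<beta>)"
  then obtain m where m: "m \<in> N \<alpha>" "m \<in> N \<beta>" "z = glue_chart \<alpha> m" by blast
  have "glue_proj m \<in> U \<beta>" using m(2) by (simp add: N_def)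
  then show "z \<in> (U \<alpha> \<inter> U \<beta>) \<times> pts S \<times> pts W"
    unfolding m(3) by (rule_tac N_cases[OF a m(1)]) (simp add: total_space_iff)
next
  fix z assume z: "z \<in> (U \<alpha> \<inter> U \<beta>) \<times> pts S \<times> pts W"
  obtain p x y where e: "z = (p, x, y)" by (cases z)
  have t: "(\<alpha>, p, x, y) \<in> total_space" "p \<in> U \<beta>" using z a unfolding e by (simp_all add: total_space_iff)
  have "cls \<alpha> p x y \<in> N \<beta>" using cls_in_quotient[OF t(1)] glue_proj_cls[OF t(1)] t(2) by (simp add: N_def)
  then show "z \<in> glue_chart \<alpha> ` (N \<alpha> \<inter> N \<beta>)"
    unfolding e using cls_in_N[OF t(1)] glue_chart_cls_same[OF t(1)]
    by (intro image_eqI[of _ _ "cls \<alpha> p x y"]) simp_all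
qed

lemma openin_overlap_X:
  assumes a: "\<alpha> \<in> A" and b: "\<beta> \<in> A"
  shows "openin (top_of (X \<alpha>)) ((U \<alpha> \<inter> U \<beta>) \<times> pts S \<times> pts W)"
proof -
  have "openin (subtopology (top_of B) (U \<alpha>)) (U \<alpha> \<inter> U \<beta>)"
    using s.openin_overlap[OF a b] s.openin_U[OF a] by (simp add: openin_open_subtopology)
  then show ?thesis by (simp add: X_def openin_prod_Times_iff)
qed

lemma smooth_map_base: "\<alpha> \<in> A \<Longrightarrow> smooth_map (X \<alpha>) B fst"
  and smooth_map_fiber\<^sub>S: "\<alpha> \<in> A \<Longrightarrow> smooth_map (X \<alpha>) S (\<lambda>z. fst (snd z))"
  and smooth_map_fiber\<^sub>W: "\<alpha> \<in> A \<Longrightarrow> smooth_map (X \<alpha>) W (\<lambda>z. snd (snd z))"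
proof -
  assume a: "\<alpha> \<in> A"
  note X = smooth_manifold_X[OF a]
  note BU = smooth_manifold_open_submfd[OF s.B s.openin_U[OF a]]
  note SW = smooth_manifold_prod_mfd[OF s.S w.S]
  note snd = smooth_map_snd[OF BU SW, folded X_def]
  show "smooth_map (X \<alpha>) B fst"
    by (rule smooth_map_compose[OF X BU s.B smooth_map_fst[OF BU SW, folded X_def]
          smooth_map_open_submfd_inclusion[OF s.B s.openin_U[OF a]]])
  show "smooth_map (X \<alpha>) S (\<lambda>z. fst (snd z))"
    by (rule smooth_map_compose[OF X SW s.S snd smooth_map_fst[OF s.S w.S]])
  show "smooth_map (X \<alpha>) W (\<lambda>z. snd (snd z))"
    by (rule smooth_map_compose[OF X SW w.S snd smooth_map_snd[OF s.S w.S]])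
qed

lemma glue_chart_transition:
  assumes a: "\<alpha> \<in> A" and b: "\<beta> \<in> A"
  shows "smooth_map (open_submfd (X \<alpha>) ((U \<alpha> \<inter> U \<beta>) \<times> pts S \<times> pts W)) (X \<beta>)
    (\<lambda>z. glue_chart \<beta> (inv_into (N \<alpha>) (glue_chart \<alpha>) z))"
proof -
  let ?Q = "(U \<alpha> \<inter> U \<beta>) \<times> pts S \<times> pts W"
  let ?Z = "open_submfd (X \<alpha>) ?Q"
  note X = smooth_manifold_X[OF a] and o = openin_overlap_X[OF a b]
  note Z = smooth_manifold_open_submfd[OF X o]
  note BU = smooth_manifold_open_submfd[OF s.B s.openin_U[OF b]]
  note SW = smooth_manifold_prod_mfd[OF s.S w.S]
  have z: "z \<in> ?Q" if "z \<in> pts ?Z" for z using that by simp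
  have fz: "fst z \<in> U \<beta> \<inter> U \<alpha>" if "z \<in> pts ?Z" for z using z[OF that] by auto
  have 1: "smooth_map ?Z B fst"
    by (rule smooth_map_restrict_domain[OF X s.B smooth_map_base[OF a] o])
  have 2: "smooth_map ?Z (open_submfd B (U \<beta>)) fst"
    by (rule smooth_map_into_open_submfd[OF 1]) (use fz in blast)
  have 3: "smooth_map ?Z S (\<lambda>z. s.tr \<beta> \<alpha> (fst z) (fst (snd z)))"
    by (rule s.smooth_map_tr[OF Z b a 1 fz smooth_map_restrict_domain[OF X s.S smooth_map_fiber\<^sub>S[OF a] o]])
  have 4: "smooth_map ?Z W (\<lambda>z. w.tr \<beta> \<alpha> (fst z) (snd (snd z)))"
    by (rule w.smooth_map_tr[OF Z b a 1 fz smooth_map_restrict_domain[OF X w.S smooth_map_fiber\<^sub>W[OF a] o]])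
  \<comment> \<open>The explicit formula is assembled one component at a time; afterwards it is
    identified with the composite of charts on the points of the overlap.\<close>
  have 5: "smooth_map ?Z (X \<beta>)
      (\<lambda>z. (fst z, s.tr \<beta> \<alpha> (fst z) (fst (snd z)), w.tr \<beta> \<alpha> (fst z) (snd (snd z))))"
    unfolding X_def[of \<beta>] by (rule smooth_map_Pair[OF Z BU SW 2 smooth_map_Pair[OF Z s.S w.S 3 4]])
  show ?thesis
  proof (rule smooth_map_cong[OF Z smooth_manifold_X[OF b] 5])
    fix z assume "z \<in> pts ?Z"
    then have zQ: "z \<in> ?Q" by (rule z)
    obtain p x y where e: "z = (p, x, y)" by (cases z)
    have t: "(\<alpha>, p, x, y) \<in> total_space" "p \<in> U \<beta>" using zQ a unfolding e by (simp_all add: total_space_iff)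
    show "(fst z, s.tr \<beta> \<alpha> (fst z) (fst (snd z)), w.tr \<beta> \<alpha> (fst z) (snd (snd z)))
        = glue_chart \<beta> (inv_into (N \<alpha>) (glue_chart \<alpha>) z)"
      unfolding e inv_glue_chart[OF t(1)] glue_chart_cls[OF t(1) b t(2)] by simp
  qed
qed

section \<open>Manifold and bundle structure on the quotient\<close>

sublocale g: manifold_gluing A N X glue_chart
proof
  fix \<alpha> \<beta> assume a: "\<alpha> \<in> A" and b: "\<beta> \<in> A"
  show "openin (top_of (X \<alpha>)) (glue_chart \<alpha> ` (N \<alpha> \<inter> N \<beta>))"
    unfolding glue_chart_overlap[OF a b] by (rule openin_overlap_X[OF a b])
  show "smooth_map (open_submfd (X \<alpha>) (glue_chart \<alpha> ` (N \<alpha> \<inter> N \<beta>))) (X \<beta>)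
      (\<lambda>x. glue_chart \<beta> (inv_into (N \<alpha>) (glue_chart \<alpha>) x))"
    unfolding glue_chart_overlap[OF a b] by (rule glue_chart_transition[OF a b])
qed (simp_all add: smooth_manifold_X bij_glue_chart)

lemma pts_glued: "pts g.glued = total_space // R"
proof (unfold g.pts_glued, intro equalityI subsetI)
  fix m assume m: "m \<in> total_space // R"
  obtain \<alpha> where "\<alpha> \<in> A" "glue_proj m \<in> U \<alpha>" using quotient_proj[OF m] .
  then show "m \<in> \<Union>(N ` A)" using m by (auto simp: N_def)
qed (auto simp: N_def)

lemma preim_glue_proj: "preim g.glued glue_proj (U \<alpha>) = N \<alpha>"
  unfolding pts_glued N_def ..

lemma Hausdorff_glued: "Hausdorff_space (top_of g.glued)"
proof (rule g.Hausdorff_glued[OF smooth_manifold_Hausdorff[OF s.B]])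
  show "continuous_map (top_of g.glued) (top_of B) glue_proj"
    by (rule g.continuous_map_from_glued[OF smooth_map_continuous[OF smooth_map_base] fst_glue_chart])
  fix m n assume "m \<in> pts g.glued" "n \<in> pts g.glued" and e: "glue_proj m = glue_proj n"
  then have mn: "m \<in> total_space // R" "n \<in> total_space // R" unfolding pts_glued by simp_all
  obtain \<alpha> where "\<alpha> \<in> A" "glue_proj m \<in> U \<alpha>" using quotient_proj[OF mn(1)] .
  then show "\<exists>\<alpha>\<in>A. m \<in> N \<alpha> \<and> n \<in> N \<alpha>" using mn e by (intro bexI[of _ \<alpha>]) (simp_all add: N_def)
qed

lemma smooth_manifold_glued: "smooth_manifold g.glued"
proof -
  obtain C where C: "countable C \<and> C \<subseteq> A \<and> (\<Union>\<alpha>\<in>C. U \<alpha>) = pts B"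
    using countable_subcover[OF smooth_manifold_second_countable[OF s.B] s.cover] by (elim exE)
  show ?thesis
  proof (rule g.smooth_manifold_glued[OF _ Hausdorff_glued, of C])
    show "finite_dimensional TYPE('be \<times> 'se \<times> 'we)"
      by (intro finite_dimensional_prod smooth_manifold_finite_dimensional[OF s.B]
          smooth_manifold_finite_dimensional[OF s.S] smooth_manifold_finite_dimensional[OF w.S])
    show "\<Union>(N ` C) = \<Union>(N ` A)"
    proof
      show "\<Union>(N ` C) \<subseteq> \<Union>(N ` A)" using C by blast
      show "\<Union>(N ` A) \<subseteq> \<Union>(N ` C)"
      proof
        fix m assume "m \<in> \<Union>(N ` A)"
        then obtain \<alpha> where a: "\<alpha> \<in> A" "m \<in> total_space // R" "glue_proj m \<in> U \<alpha>" by (auto simp: N_def)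
        have "glue_proj m \<in> pts B" using s.U_subset[OF a(1)] a(3) by blast
        then have "glue_proj m \<in> (\<Union>\<alpha>\<in>C. U \<alpha>)" using C by simp
        then show "m \<in> \<Union>(N ` C)" using a(2) by (auto simp: N_def)
      qed
    qed
  qed (use C in simp_all)
qed

lemma smooth_map_glue_proj: "smooth_map g.glued B glue_proj"
  by (rule g.smooth_map_from_glued[OF smooth_manifold_glued s.B smooth_map_base fst_glue_chart])

lemma bundle_chart_glue_chart:
  assumes a: "\<alpha> \<in> A"
  shows "bundle_chart g.glued B (S \<times>\<^sub>M W) glue_proj (U \<alpha>) (glue_chart \<alpha>)"
  unfolding bundle_chart_def preim_glue_proj
  using s.openin_U[OF a] g.diffeomorphism_glued[OF a] fst_glue_chart[OF a] by (simp add: X_def)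

lemma cover_U: "(\<Union>\<alpha>\<in>A. U \<alpha>) = pts B"
  using s.cover by (simp add: open_cover_def)

lemma bundle_atlas_glue_chart: "bundle_atlas g.glued B (S \<times>\<^sub>M W) glue_proj A U glue_chart"
  unfolding bundle_atlas_def using bundle_chart_glue_chart cover_U by simp

lemma fiber_bundle_glued: "fiber_bundle g.glued B (S \<times>\<^sub>M W) glue_proj"
  unfolding fiber_bundle_def
proof (intro conjI ballI)
  fix p assume "p \<in> pts B"
  then obtain \<alpha> where "\<alpha> \<in> A" "p \<in> U \<alpha>" using cover_U by blast
  then show "\<exists>U \<phi>. p \<in> U \<and> bundle_chart g.glued B (S \<times>\<^sub>M W) glue_proj U \<phi>"
    using bundle_chart_glue_chart by blast
qed (rule smooth_manifold_glued s.B smooth_manifold_prod_mfd[OF s.S w.S] smooth_map_glue_proj)+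

section \<open>Preservation of the two families of slices\<close>

text \<open>Each fiber coordinate in the new chart depends on the base point and on the
  corresponding old coordinate alone; this separation is what conditions (i) and (ii)
  express.\<close>

lemma glue_chart_change:
  assumes ab: "\<alpha> \<in> A" "\<beta> \<in> A" and m: "m \<in> N \<alpha>" "m \<in> N \<beta>"
  shows "glue_chart \<beta> m = (glue_proj m, s.tr \<beta> \<alpha> (glue_proj m) (fst (snd (glue_chart \<alpha> m))),
    w.tr \<beta> \<alpha> (glue_proj m) (snd (snd (glue_chart \<alpha> m))))"
proof -
  obtain x y where xy: "(\<alpha>, glue_proj m, x, y) \<in> total_space" "m = cls \<alpha> (glue_proj m) x y"
    "glue_chart \<alpha> m = (glue_proj m, x, y)" using N_cases[OF ab(1) m(1)] .
  have "glue_proj m \<in> U \<beta>" using m(2) by (simp add: N_def)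
  from glue_chart_cls[OF xy(1) ab(2) this] show ?thesis unfolding xy(2)[symmetric] xy(3) by simp
qed

text \<open>Inclusions suffice, as exchanging the two indices gives the converse ones.\<close>

lemma slices_subset:
  assumes ab: "\<alpha> \<in> A" "\<beta> \<in> A" and m: "m \<in> N \<alpha>" "m \<in> N \<beta>"
  shows "{n \<in> N \<alpha>. glue_chart \<alpha> n \<in> {glue_proj m} \<times> pts S \<times> {snd (snd (glue_chart \<alpha> m))}} \<subseteq>
      {n \<in> N \<beta>. glue_chart \<beta> n \<in> {glue_proj m} \<times> pts S \<times> {snd (snd (glue_chart \<beta> m))}}" (is ?S)
    and "{n \<in> N \<alpha>. glue_chart \<alpha> n \<in> {glue_proj m} \<times> {fst (snd (glue_chart \<alpha> m))} \<times> pts W} \<subseteq>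
      {n \<in> N \<beta>. glue_chart \<beta> n \<in> {glue_proj m} \<times> {fst (snd (glue_chart \<beta> m))} \<times> pts W}" (is ?W)
proof -
  \<comment> \<open>Over a common base point the same two fiber maps act on \<open>n\<close> and on
    \<open>m\<close>, so a fiber coordinate shared in one chart is shared in the other.\<close>
  have *: "n \<in> N \<beta> \<and> glue_proj n = glue_proj m \<and>
      glue_chart \<beta> n = (glue_proj m, s.tr \<beta> \<alpha> (glue_proj m) (fst (snd (glue_chart \<alpha> n))),
        w.tr \<beta> \<alpha> (glue_proj m) (snd (snd (glue_chart \<alpha> n)))) \<and>
      s.tr \<beta> \<alpha> (glue_proj m) (fst (snd (glue_chart \<alpha> n))) \<in> pts S \<and>
      w.tr \<beta> \<alpha> (glue_proj m) (snd (snd (glue_chart \<alpha> n))) \<in> pts W"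
    if n: "n \<in> N \<alpha>" "fst (glue_chart \<alpha> n) = glue_proj m" for n
  proof -
    have e: "glue_proj n = glue_proj m" using fst_glue_chart[OF ab(1) n(1)] n(2) by simp
    have nb: "n \<in> N \<beta>" using n(1) m(2) e by (simp add: N_def)
    have "glue_chart \<beta> n \<in> pts (X \<beta>)" using g.image_N[OF ab(2)] nb by blast
    then show ?thesis using e nb glue_chart_change[OF ab n(1) nb] by (simp add: pts_X[OF ab(2)])
  qed
  note c = glue_chart_change[OF ab m]
  show ?S
  proof
    fix n assume "n \<in> {n \<in> N \<alpha>. glue_chart \<alpha> n \<in> {glue_proj m} \<times> pts S \<times> {snd (snd (glue_chart \<alpha> m))}}"
    then have n: "n \<in> N \<alpha>" "fst (glue_chart \<alpha> n) = glue_proj m"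
      "snd (snd (glue_chart \<alpha> n)) = snd (snd (glue_chart \<alpha> m))" by (auto simp: mem_Times_iff)
    show "n \<in> {n \<in> N \<beta>. glue_chart \<beta> n \<in> {glue_proj m} \<times> pts S \<times> {snd (snd (glue_chart \<beta> m))}}"
      using *[OF n(1,2)] n(3) c by (simp add: mem_Times_iff)
  qed
  show ?W
  proof
    fix n assume "n \<in> {n \<in> N \<alpha>. glue_chart \<alpha> n \<in> {glue_proj m} \<times> {fst (snd (glue_chart \<alpha> m))} \<times> pts W}"
    then have n: "n \<in> N \<alpha>" "fst (glue_chart \<alpha> n) = glue_proj m"
      "fst (snd (glue_chart \<alpha> n)) = fst (snd (glue_chart \<alpha> m))" by (auto simp: mem_Times_iff)
    show "n \<in> {n \<in> N \<beta>. glue_chart \<beta> n \<in> {glue_proj m} \<times> {fst (snd (glue_chart \<beta> m))} \<times> pts W}"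
      using *[OF n(1,2)] n(3) c by (simp add: mem_Times_iff)
  qed
qed

lemma multi_fiber_atlas_glue_chart: "multi_fiber_atlas g.glued B S W glue_proj A U glue_chart"
  unfolding multi_fiber_atlas_def preim_glue_proj
proof (intro conjI ballI impI)
  fix \<alpha> \<beta> m assume ab: "\<alpha> \<in> A" "\<beta> \<in> A" and "m \<in> preim g.glued glue_proj (U \<alpha> \<inter> U \<beta>)"
  then have m: "m \<in> N \<alpha>" "m \<in> N \<beta>" unfolding pts_glued N_def by simp_all
  show "{n \<in> N \<alpha>. glue_chart \<alpha> n \<in> {glue_proj m} \<times> pts S \<times> {snd (snd (glue_chart \<alpha> m))}} =
      {n \<in> N \<beta>. glue_chart \<beta> n \<in> {glue_proj m} \<times> pts S \<times> {snd (snd (glue_chart \<beta> m))}}"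
    by (rule equalityI[OF slices_subset(1)[OF ab m] slices_subset(1)[OF ab(2,1) m(2,1)]])
  show "{n \<in> N \<alpha>. glue_chart \<alpha> n \<in> {glue_proj m} \<times> {fst (snd (glue_chart \<alpha> m))} \<times> pts W} =
      {n \<in> N \<beta>. glue_chart \<beta> n \<in> {glue_proj m} \<times> {fst (snd (glue_chart \<beta> m))} \<times> pts W}"
    by (rule equalityI[OF slices_subset(2)[OF ab m] slices_subset(2)[OF ab(2,1) m(2,1)]])
qed (rule bundle_atlas_glue_chart)

end

text \<open>The conditions involve an index only through its domain and chart, so the family can be
  replaced by its set of pairs, the form in which \<open>multi_fiber_bundle\<close> asks for an
  atlas.\<close>

lemma multi_fiber_atlas_self_indexed:
  assumes "multi_fiber_atlas M B S W \<pi> A U \<phi>"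
  shows "multi_fiber_atlas M B S W \<pi> ((\<lambda>\<alpha>. (U \<alpha>, \<phi> \<alpha>)) ` A) fst snd"
  using assms unfolding multi_fiber_atlas_def bundle_atlas_def by (simp add: image_image)

theorem mainTheorem1:
  fixes B :: "('b, 'be::real_normed_vector) mfd"
    and S :: "('s, 'se::real_normed_vector) mfd"
    and W :: "('w, 'we::real_normed_vector) mfd"
    and H :: "'h monoid" and H_mfd :: "('h, 'he::real_normed_vector) mfd"
    and F :: "'f monoid" and F_mfd :: "('f, 'fe::real_normed_vector) mfd"
    and act\<^sub>S :: "'h \<Rightarrow> 's \<Rightarrow> 's" and act\<^sub>W :: "'f \<Rightarrow> 'w \<Rightarrow> 'w"
    and A :: "'i set" and U :: "'i \<Rightarrow> 'b set"
    and h :: "'i \<Rightarrow> 'i \<Rightarrow> 'b \<Rightarrow> 'h" and f :: "'i \<Rightarrow> 'i \<Rightarrow> 'b \<Rightarrow> 'f"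
  assumes "smooth_manifold B"
    and "smooth_manifold S" and "compact_space (top_of S)"
    and "smooth_manifold W" and "compact_space (top_of W)"
    and "lie_group H H_mfd" and "smooth_left_action H H_mfd S act\<^sub>S"
    and "lie_group F F_mfd" and "smooth_left_action F F_mfd W act\<^sub>W"
    and "open_cover B A U"
    and "cocycle H H_mfd B A U h"
    and "cocycle F F_mfd B A U f"
  shows "let \<Sigma> = glue_total A U (pts S) (pts W);
             R = glue_rel A U (pts S) (pts W) act\<^sub>S h act\<^sub>W f
         in equiv \<Sigma> R \<and>
            (\<forall>(\<alpha>, p, x, y) \<in> \<Sigma>. glue_proj (R `` {(\<alpha>, p, x, y)}) = p) \<and>
            (\<forall>\<alpha>\<in>A. \<forall>m \<in> \<Sigma> // R. glue_proj m \<in> U \<alpha> \<longrightarrow>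
              (\<exists>!q. (\<alpha>, q) \<in> m) \<and> glue_chart \<alpha> m \<in> U \<alpha> \<times> pts S \<times> pts W) \<and>
            (\<exists>M :: (('i \<times> 'b \<times> 's \<times> 'w) set, 'be \<times> 'se \<times> 'we) mfd.
              smooth_manifold M \<and> pts M = \<Sigma> // R \<and>
              fiber_bundle M B (S \<times>\<^sub>M W) glue_proj \<and>
              bundle_atlas M B (S \<times>\<^sub>M W) glue_proj A U glue_chart \<and>
              multi_fiber_atlas M B S W glue_proj A U glue_chart \<and>
              multi_fiber_bundle M B S W glue_proj)"
proof -
  interpret cocycle_gluing H H_mfd B S act\<^sub>S A U h F F_mfd W act\<^sub>W f
    by unfold_locales (rule assms)+
  have equiv: "equiv total_space R" by (rule equiv_R)
  have proj: "\<forall>(\<alpha>, p, x, y) \<in> total_space. glue_proj (R `` {(\<alpha>, p, x, y)}) = p"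
    using glue_proj_cls by auto
  have chart: "(\<exists>!q. (\<alpha>, q) \<in> m) \<and> glue_chart \<alpha> m \<in> U \<alpha> \<times> pts S \<times> pts W"
    if a: "\<alpha> \<in> A" and m: "m \<in> total_space // R" and p: "glue_proj m \<in> U \<alpha>" for \<alpha> m
  proof -
    have "m \<in> N \<alpha>" using m p by (simp add: N_def)
    from N_cases[OF a this] obtain x y where xy: "(\<alpha>, glue_proj m, x, y) \<in> total_space"
      "m = cls \<alpha> (glue_proj m) x y" "glue_chart \<alpha> m = (glue_proj m, x, y)" .
    \<comment> \<open>Written as a class, \<open>m\<close> contains \<open>(\<alpha>, q)\<close>
      exactly when \<open>q\<close> equals an explicit triple.\<close>
    have "\<exists>!q. (\<alpha>, q) \<in> cls \<alpha> (glue_proj m) x y"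
      unfolding cls_mem_iff[OF xy(1) a p] by simp
    then have "\<exists>!q. (\<alpha>, q) \<in> m" unfolding xy(2)[symmetric] .
    then show ?thesis using xy(1) unfolding xy(3) total_space_iff by simp
  qed
  have "\<exists>C. multi_fiber_atlas g.glued B S W glue_proj C fst snd"
    by (rule exI, rule multi_fiber_atlas_self_indexed[OF multi_fiber_atlas_glue_chart])
  then have "multi_fiber_bundle g.glued B S W glue_proj"
    unfolding multi_fiber_bundle_def by (intro conjI assms fiber_bundle_glued)
  then show ?thesis
    unfolding Let_def total_space_def[symmetric] R_def[symmetric]
    using equiv proj chart smooth_manifold_glued pts_glued fiber_bundle_glued
      bundle_atlas_glue_chart multi_fiber_atlas_glue_chart
    by (intro conjI exI[of _ g.glued] ballI impI) simp_all
qed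

end
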